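(* Let $d\ge 1$ and let $p(x), g_1(x),\dots,g_m(x)$ be convex SPQ polynomials in $n$ variables of degree at most $2d$. Consider the polynomial optimization problem $$p^* := \inf_{x\in\mathbb{R}^n} p(x)\quad\text{s.t.}\quad x\in K,\qquad K:=\{x\in\mathbb{R}^n \mid g_i(x)\le 0,\ i=1,\dots,m\},$$ and assume that the Slater regularity condition holds, i.e., there exists $\bar x\in\mathbb{R}^n$ such that $g_i(\bar x)<0$ for $i=1,\dots,m$. Then the optimal value $p^*$ can be computed by solving the following semidefinite program: $$p^* \;=\; \sup_{\gamma\in\mathbb{R},\,y\in\mathbb{R}^m}\ \gamma\quad\text{s.t.}\quad p(x)-\gamma+\sum_{i=1}^m y_i g_i(x)\in (N^S+N^Q)_{n,2d},\quad y\ge 0.$$ Moreover, if $p(x)$ is strictly convex, then an optimal solution of the polynomial optimization problem, i.e., a point $x^*\in K$ such that $p(x^* )=p^*$, can be found by finding zeros of at most $n$ nonnegative univariate polynomials and at most one nonnegative quadratic polynomial, which can be obtained by solving a semidefinite program.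
   Context: All polynomials have real coefficients. A polynomial in $n$ variables is separable if it equals $\sum_{i=1}^n s_i(x_i)$ for some univariate polynomials $s_i$; it is separable plus quadratic (SPQ) if it is the sum of a separable polynomial and a quadratic polynomial (degree at most $2$, not necessarily homogeneous). A polynomial is nonnegative if it is $\ge 0$ on all of $\mathbb{R}^n$. $(N^S+N^Q)_{n,2d}$ denotes the set of SPQ polynomials in $n$ variables and of degree at most $2d$ that can be written as the sum of a nonnegative separable polynomial and a nonnegative quadratic polynomial. $y\ge 0$ is meant entrywise, and the supremum of the empty set is $-\infty$. Membership in $(N^S+N^Q)_{n,2d}$ is a semidefinite constraint: one writes the polynomial as $q(x)+\sum_{i=1}^n u_i(x_i)$ with $q$ quadratic and each $u_i$ univariate of degree at most $2d$, and requires $q,u_1,\dots,u_n$ to be sums of squares (equivalently, nonnegative), i.e., to be of the form $z^TQz$ with $Q$ positive semidefinite and $z$ a vector of monomials. A semidefinite program is the optimization of a linear function subject to affine equalities and positive semidefiniteness of symmetric matrices depending affinely on the decision variables. "Found by finding zeros" means: from an optimal solution of a semidefinite program constructed from the problem data one reads off univariate polynomials in (some of) the variables and a quadratic polynomial, all nonnegative, and the coordinates of $x^*$ are obtained by solving for zeros of these univariate polynomials and then for a zero of the quadratic polynomial in the remaining coordinates. *)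

theory Defs
  imports
    "HOL-Analysis.Analysis"
    "HOL-Library.Poly_Mapping"
    "HOL-Computational_Algebra.Polynomial"
begin

section \<open>Real polynomials in the variables \<open>x\<^sub>i\<close>, \<open>i :: 'n\<close>\<close>

text \<open>A monomial is its exponent vector, a polynomial its finitely supported coefficient family;
  ring operations are those of \<^theory>\<open>HOL-Library.Poly_Mapping\<close>. The number of variables is
  \<open>CARD('n)\<close>.\<close>

type_synonym 'n mono = "'n \<Rightarrow>\<^sub>0 nat"
type_synonym 'n mpoly = "'n mono \<Rightarrow>\<^sub>0 real"

definition mono_deg :: "'n::finite mono \<Rightarrow> nat" where
  "mono_deg \<alpha> = (\<Sum>i\<in>UNIV. Poly_Mapping.lookup \<alpha> i)"

definition total_degree :: "'n::finite mpoly \<Rightarrow> nat" where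
  "total_degree f = Max (insert 0 (mono_deg ` Poly_Mapping.keys f))"

definition meval :: "'n::finite mpoly \<Rightarrow> real ^ 'n \<Rightarrow> real" where
  "meval f x = (\<Sum>\<alpha>\<in>Poly_Mapping.keys f.
     Poly_Mapping.lookup f \<alpha> * (\<Prod>i\<in>UNIV. (x $ i) ^ Poly_Mapping.lookup \<alpha> i))"

definition mconst :: "real \<Rightarrow> 'n mpoly" where
  "mconst c = Poly_Mapping.single 0 c"

text \<open>The monomial \<open>x\<^sub>i^k\<close>, and the univariate polynomial \<open>s\<close> read as \<open>s(x\<^sub>i)\<close>.\<close>

definition var_pow :: "'n \<Rightarrow> nat \<Rightarrow> 'n mono" where
  "var_pow i k = Poly_Mapping.single i k"

definition in_var :: "'n \<Rightarrow> real poly \<Rightarrow> 'n mpoly" where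
  "in_var i s = (\<Sum>k\<le>degree s. Poly_Mapping.single (var_pow i k) (coeff s k))"

definition nonneg :: "'n::finite mpoly \<Rightarrow> bool" where
  "nonneg f \<longleftrightarrow> (\<forall>x. 0 \<le> meval f x)"

definition separable :: "'n::finite mpoly \<Rightarrow> bool" where
  "separable f \<longleftrightarrow> (\<exists>s :: 'n \<Rightarrow> real poly. f = (\<Sum>i\<in>UNIV. in_var i (s i)))"

definition quadratic :: "'n::finite mpoly \<Rightarrow> bool" where
  "quadratic f \<longleftrightarrow> total_degree f \<le> 2"

definition spq :: "'n::finite mpoly \<Rightarrow> bool" where
  "spq f \<longleftrightarrow> (\<exists>s q. separable s \<and> quadratic q \<and> f = s + q)"

text \<open>The set \<open>(N\<^sup>S + N\<^sup>Q)\<close> in \<open>CARD('n)\<close> variables and of degree at most \<open>2d\<close>.\<close>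

definition NS_plus_NQ :: "nat \<Rightarrow> 'n::finite mpoly set" where
  "NS_plus_NQ d = {f. spq f \<and> total_degree f \<le> 2 * d \<and>
     (\<exists>s q. separable s \<and> nonneg s \<and> quadratic q \<and> nonneg q \<and> f = s + q)}"

definition strictly_convex :: "('a::real_vector \<Rightarrow> real) \<Rightarrow> bool" where
  "strictly_convex f \<longleftrightarrow> (\<forall>x y t. x \<noteq> y \<and> 0 < t \<and> t < 1 \<longrightarrow>
     f ((1 - t) *\<^sub>R x + t *\<^sub>R y) < (1 - t) * f x + t * f y)"

section \<open>The polynomial optimization problem\<close>

text \<open>The constraints are \<open>g 0, \<dots>, g (m - 1)\<close>; values of \<open>g\<close> and of the multipliers \<open>y\<close> at
  indices \<open>\<ge> m\<close> play no role.\<close>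

definition constraint_set :: "nat \<Rightarrow> (nat \<Rightarrow> 'n::finite mpoly) \<Rightarrow> (real ^ 'n) set" where
  "constraint_set m g = {x. \<forall>i<m. meval (g i) x \<le> 0}"

definition opt_value :: "'n::finite mpoly \<Rightarrow> nat \<Rightarrow> (nat \<Rightarrow> 'n mpoly) \<Rightarrow> ereal" where
  "opt_value p m g = (INF x\<in>constraint_set m g. ereal (meval p x))"

definition lagrangian ::
  "'n::finite mpoly \<Rightarrow> nat \<Rightarrow> (nat \<Rightarrow> 'n mpoly) \<Rightarrow> real \<Rightarrow> (nat \<Rightarrow> real) \<Rightarrow> 'n mpoly" where
  "lagrangian p m g \<gamma> y = p - mconst \<gamma> + (\<Sum>i<m. mconst (y i) * g i)"

definition dual_feasible ::
  "nat \<Rightarrow> 'n::finite mpoly \<Rightarrow> nat \<Rightarrow> (nat \<Rightarrow> 'n mpoly) \<Rightarrow> (real \<times> (nat \<Rightarrow> real)) set" where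
  "dual_feasible d p m g =
     {(\<gamma>, y). lagrangian p m g \<gamma> y \<in> NS_plus_NQ d \<and> (\<forall>i<m. 0 \<le> y i)}"

section \<open>Semidefinite programs\<close>

text \<open>Decision vectors are functions \<open>'v \<Rightarrow> real\<close>, of which only the coordinates in the finite set
  \<open>decision_vars\<close> matter; the objective is maximized. Each member of \<open>equations\<close> is an affine form
  required to vanish; each member \<open>(B, M)\<close> of \<open>lmis\<close> is a symmetric matrix with rows and columns
  indexed by the finite set \<open>B\<close>, depending affinely on the decision vector and required to be
  positive semidefinite. The predicate \<open>semidefinite_program\<close> states these requirements on the
  data.\<close>

record ('v, 'r) sdp =
  decision_vars :: "'v set"
  objective :: "('v \<Rightarrow> real) \<Rightarrow> real"
  equations :: "(('v \<Rightarrow> real) \<Rightarrow> real) set"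
  lmis :: "('r set \<times> (('v \<Rightarrow> real) \<Rightarrow> 'r \<Rightarrow> 'r \<Rightarrow> real)) set"

definition linear_form :: "'v set \<Rightarrow> (('v \<Rightarrow> real) \<Rightarrow> real) \<Rightarrow> bool" where
  "linear_form V e \<longleftrightarrow> (\<exists>a. \<forall>v. e v = (\<Sum>j\<in>V. a j * v j))"

definition affine_form :: "'v set \<Rightarrow> (('v \<Rightarrow> real) \<Rightarrow> real) \<Rightarrow> bool" where
  "affine_form V e \<longleftrightarrow> (\<exists>c a. \<forall>v. e v = c + (\<Sum>j\<in>V. a j * v j))"

definition semidefinite_program :: "('v, 'r) sdp \<Rightarrow> bool" where
  "semidefinite_program P \<longleftrightarrow>
     finite (decision_vars P) \<and> finite (equations P) \<and> finite (lmis P) \<and>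
     linear_form (decision_vars P) (objective P) \<and>
     (\<forall>e\<in>equations P. affine_form (decision_vars P) e) \<and>
     (\<forall>(B, M)\<in>lmis P. finite B \<and>
        (\<forall>r\<in>B. \<forall>s\<in>B. affine_form (decision_vars P) (\<lambda>v. M v r s) \<and> (\<forall>v. M v r s = M v s r)))"

definition psd_on :: "'r set \<Rightarrow> ('r \<Rightarrow> 'r \<Rightarrow> real) \<Rightarrow> bool" where
  "psd_on B M \<longleftrightarrow> (\<forall>r\<in>B. \<forall>s\<in>B. M r s = M s r) \<and>
     (\<forall>z :: 'r \<Rightarrow> real. 0 \<le> (\<Sum>r\<in>B. \<Sum>s\<in>B. z r * M r s * z s))"

definition sdp_feasible :: "('v, 'r) sdp \<Rightarrow> ('v \<Rightarrow> real) set" where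
  "sdp_feasible P = {v. (\<forall>e\<in>equations P. e v = 0) \<and> (\<forall>(B, M)\<in>lmis P. psd_on B (M v))}"

definition sdp_value :: "('v, 'r) sdp \<Rightarrow> ereal" where
  "sdp_value P = (SUP v\<in>sdp_feasible P. ereal (objective P v))"

definition sdp_optimal :: "('v, 'r) sdp \<Rightarrow> ('v \<Rightarrow> real) set" where
  "sdp_optimal P =
     {v \<in> sdp_feasible P. \<forall>w\<in>sdp_feasible P. objective P w \<le> objective P v}"

section \<open>The semidefinite programs for SPQ optimization\<close>

text \<open>Gram matrices: \<open>Quad\<close> for the quadratic part, \<open>Univ i\<close> for the univariate part in \<open>x\<^sub>i\<close>, and
  \<open>Curv i\<close> for the second derivative of the latter. They are indexed by monomials, and the
  entry at \<open>(\<alpha>, \<beta>)\<close> is the decision variable \<open>Gram b {\<alpha>, \<beta>}\<close>; the unordered pair makes the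
  matrices symmetric.\<close>

datatype 'n block = Quad | Univ 'n | Curv 'n

datatype 'n dvar = Gamma | Mult nat | Gram "'n block" "'n mono set"

primrec basis :: "nat \<Rightarrow> 'n::finite block \<Rightarrow> 'n mono set" where
  "basis d Quad = {\<alpha>. mono_deg \<alpha> \<le> 1}"
| "basis d (Univ i) = var_pow i ` {..d}"
| "basis d (Curv i) = var_pow i ` {..<d}"

definition gram :: "'n block \<Rightarrow> ('n dvar \<Rightarrow> real) \<Rightarrow> 'n mono \<Rightarrow> 'n mono \<Rightarrow> real" where
  "gram b v \<alpha> \<beta> = v (Gram b {\<alpha>, \<beta>})"

definition gram_vars :: "nat \<Rightarrow> 'n::finite block \<Rightarrow> 'n dvar set" where
  "gram_vars d b = (\<lambda>(\<alpha>, \<beta>). Gram b {\<alpha>, \<beta>}) ` (basis d b \<times> basis d b)"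

text \<open>The polynomials \<open>z\<^sup>T Q z\<close> read off from a decision vector.\<close>

definition quad_part :: "('n::finite dvar \<Rightarrow> real) \<Rightarrow> 'n mpoly" where
  "quad_part v = (\<Sum>\<alpha> | mono_deg \<alpha> \<le> 1. \<Sum>\<beta> | mono_deg \<beta> \<le> 1.
     Poly_Mapping.single (\<alpha> + \<beta>) (gram Quad v \<alpha> \<beta>))"

definition univ_part :: "nat \<Rightarrow> ('n dvar \<Rightarrow> real) \<Rightarrow> 'n \<Rightarrow> real poly" where
  "univ_part d v i =
     (\<Sum>k\<le>d. \<Sum>l\<le>d. monom (gram (Univ i) v (var_pow i k) (var_pow i l)) (k + l))"

definition curv_part :: "nat \<Rightarrow> ('n dvar \<Rightarrow> real) \<Rightarrow> 'n \<Rightarrow> real poly" where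
  "curv_part d v i =
     (\<Sum>k<d. \<Sum>l<d. monom (gram (Curv i) v (var_pow i k) (var_pow i l)) (k + l))"

text \<open>Maximize \<open>\<gamma>\<close> subject to \<open>p - \<gamma> + \<Sum>\<^sub>i y\<^sub>i g\<^sub>i = q + \<Sum>\<^sub>i u\<^sub>i(x\<^sub>i)\<close>, coefficient by coefficient,
  with \<open>y \<ge> 0\<close> (as \<open>1 \<times> 1\<close> blocks) and \<open>q, u\<^sub>i\<close> given by positive semidefinite Gram matrices.\<close>

definition spq_sdp ::
  "nat \<Rightarrow> 'n::finite mpoly \<Rightarrow> nat \<Rightarrow> (nat \<Rightarrow> 'n mpoly) \<Rightarrow> ('n dvar, 'n mono) sdp" where
  "spq_sdp d p m g = \<lparr>
     decision_vars = {Gamma} \<union> Mult ` {..<m} \<union> gram_vars d Quad \<union> (\<Union>i. gram_vars d (Univ i)),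
     objective = (\<lambda>v. v Gamma),
     equations = (\<lambda>\<mu> v. Poly_Mapping.lookup
         (lagrangian p m g (v Gamma) (\<lambda>i. v (Mult i))
           - (quad_part v + (\<Sum>i\<in>UNIV. in_var i (univ_part d v i)))) \<mu>)
       ` {\<mu>. mono_deg \<mu> \<le> 2 * d},
     lmis = (\<lambda>i. ({0}, \<lambda>v _ _. v (Mult i))) ` {..<m}
       \<union> {(basis d Quad, gram Quad)} \<union> range (\<lambda>i. (basis d (Univ i), gram (Univ i)))\<rparr>"

text \<open>The same program with the additional requirement that each \<open>u\<^sub>i''\<close> also has a positive
  semidefinite Gram matrix. It makes the \<open>u\<^sub>i\<close> convex, and a nonzero nonnegative convex polynomial in
  one variable has at most one zero, so zeros can be computed one coordinate at a time.\<close>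

definition spq_sdp_convex ::
  "nat \<Rightarrow> 'n::finite mpoly \<Rightarrow> nat \<Rightarrow> (nat \<Rightarrow> 'n mpoly) \<Rightarrow> ('n dvar, 'n mono) sdp" where
  "spq_sdp_convex d p m g = (let P = spq_sdp d p m g in \<lparr>
     decision_vars = decision_vars P \<union> (\<Union>i. gram_vars d (Curv i)),
     objective = objective P,
     equations = equations P
       \<union> (\<lambda>(i, k) v. coeff (pderiv (pderiv (univ_part d v i)) - curv_part d v i) k)
           ` (UNIV \<times> {..2 * d}),
     lmis = lmis P \<union> range (\<lambda>i. (basis d (Curv i), gram (Curv i)))\<rparr>)"

end

theory Submission
  imports Defs "HOL-Computational_Algebra.Fundamental_Theorem_Algebra"
begin

text \<open>
  Varying the coordinates of \<open>x\<close> independently in the Hessian shows that a convex SPQ polynomial is a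
  convex separable plus a convex quadratic polynomial. If it is also nonnegative, it attains its
  minimum, at \<open>a\<close> say, and subtracting from each univariate summand its tangent at \<open>a\<close> and adding it
  to the quadratic part makes both parts nonnegative. Under Slater's condition this applies to the
  Lagrangian \<open>p - p\<^sup>* + \<Sum> y\<^sub>i g\<^sub>i\<close> at optimal multipliers, so the dual bound \<open>p\<^sup>*\<close> is attained, with
  convex univariate parts. At an optimal \<open>x\<^sup>*\<close> every part of such a certificate vanishes, and if \<open>p\<close> is
  strictly convex, then so is the certificate, and it has no other zero.
\<close>

section \<open>Univariate polynomials\<close>

text \<open>Tangents are taken at a minimizer of the whole polynomial because there the first-order
  terms of the quadratic remainder vanish together with those of the univariate parts. Existence of
  such a minimizer is the main obstacle: a convex function bounded below need not attain its
  infimum, and the Lagrangian need not be strictly convex. What helps is that a polynomial bounded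
  on a half-line is constant. A direction in which a sublevel set is unbounded is therefore a
  direction of constancy and can be factored out. The multipliers come from the inequality
  \<open>c \<le> p\<close> on \<open>K\<close> alone, so strong duality does not presuppose that
  \<open>p\<close> attains its infimum on \<open>K\<close>; attainment is shown separately for
  strictly convex \<open>p\<close>. First and second order conditions in several variables are read
  off along lines, as coefficients 1 and 2 of a univariate polynomial.\<close>

lemma nonneg_poly_double_root:
  fixes p :: "real poly"
  assumes nonneg: "\<And>t. 0 \<le> poly p t" and root: "poly p r = 0"
  obtains q where "p = [:-r, 1:]\<^sup>2 * q" "\<And>t. 0 \<le> poly q t"
proof -
  obtain p1 where p1: "p = [:-r, 1:] * p1"
    using root by (auto simp: poly_eq_0_iff_dvd)
  \<comment> \<open>A root of a nonnegative polynomial is a local minimum, so the derivative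
    vanishes as well and supplies the second linear factor.\<close>
  have "poly (pderiv p) r = 0"
    using DERIV_local_min[OF poly_DERIV[of p r], of 1] nonneg root by simp
  then have "poly p1 r = 0"
    unfolding p1 pderiv_mult by (simp add: pderiv_pCons)
  then obtain q where "p1 = [:-r, 1:] * q"
    by (auto simp: poly_eq_0_iff_dvd)
  then have q: "p = [:-r, 1:]\<^sup>2 * q"
    by (simp only: p1 power2_eq_square mult.assoc)
  have away: "0 \<le> poly q t" if "t \<noteq> r" for t
    using nonneg[of t] that by (auto simp: q zero_le_mult_iff poly_power)
  \<comment> \<open>At \<open>r\<close> the factorization gives no sign for \<open>q\<close>;
    continuity carries it over from the points \<open>t \<noteq> r\<close>.\<close>
  have "(poly q \<longlongrightarrow> poly q r) (at r)"
    using poly_isCont isCont_def by blast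
  then have "0 \<le> poly q r"
    by (rule tendsto_lowerbound) (auto simp: eventually_at away intro!: exI[of _ 1])
  then show thesis
    using that[OF q] away by metis
qed

text \<open>The double root at 0 shifts the coefficients by two. Applied to restrictions to lines,
  where these coefficients are the first derivative and half the second derivative.\<close>

lemma nonneg_poly_root_0:
  fixes p :: "real poly"
  assumes "\<And>t. 0 \<le> poly p t" "poly p 0 = 0"
  shows "coeff p 1 = 0" "0 \<le> coeff p 2"
proof -
  obtain q where q: "p = [:0, 1:]\<^sup>2 * q" "\<And>t. 0 \<le> poly q t"
    using nonneg_poly_double_root[OF assms] by auto
  have "p = pCons 0 (pCons 0 q)"
    by (simp add: q power2_eq_square)
  then show "coeff p 1 = 0" "0 \<le> coeff p 2"
    using q(2)[of 0] by (auto simp: poly_0_coeff_0 numeral_2_eq_2)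
qed

text \<open>A nonconstant polynomial is unbounded in absolute value at infinity, so a nonnegative
  one exceeds \<open>poly p 0\<close> outside a compact ball around 0.\<close>

lemma nonneg_poly_attains_min:
  fixes p :: "real poly"
  assumes nonneg: "\<And>t. 0 \<le> poly p t"
  obtains r where "\<And>t. poly p r \<le> poly p t"
proof (cases p)
  case (pCons a q)
  show thesis
  proof (cases "q = 0")
    case True
    then show thesis using that[of 0] by (simp add: pCons)
  next
    case False
    then obtain R where R: "\<And>t. R \<le> \<bar>t\<bar> \<Longrightarrow> poly p 0 \<le> \<bar>poly p t\<bar>"
      using poly_infinity[of q "poly p 0" a] by (auto simp: pCons)
    \<comment> \<open>The radius \<open>\<bar>R\<bar>\<close> keeps 0 in the ball even if
      \<open>R\<close> is negative.\<close>
    have "continuous_on (cball 0 \<bar>R\<bar>) (poly p)"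
      by (intro continuous_intros)
    then obtain r where r: "\<And>t. t \<in> cball 0 \<bar>R\<bar> \<Longrightarrow> poly p r \<le> poly p t"
      using continuous_attains_inf[OF compact_cball] by (metis cball_eq_empty abs_ge_zero not_less)
    have "poly p r \<le> poly p t" for t
      using r[of t] r[of 0] R[of t] nonneg[of t] by (cases "\<bar>t\<bar> \<le> \<bar>R\<bar>"; cases "R \<le> \<bar>t\<bar>") auto
    then show thesis by (rule that)
  qed
qed

text \<open>After subtraction of the minimum \<open>c\<close> the polynomial has a root at the
  minimizer \<open>r\<close>, hence a factor \<open>(t - r)^2\<close>. The quotient has degree two
  less and is a sum of squares by induction; \<open>c\<close> itself is the square of
  \<open>sqrt c\<close>.\<close>

lemma nonneg_poly_sos:
  fixes p :: "real poly"
  assumes "\<And>t. 0 \<le> poly p t" "degree p \<le> 2 * d"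
  obtains fs where "p = (\<Sum>f\<leftarrow>fs. f\<^sup>2)" "\<forall>f\<in>set fs. degree f \<le> d"
proof -
  have "\<exists>fs. p = (\<Sum>f\<leftarrow>fs. f\<^sup>2) \<and> (\<forall>f\<in>set fs. degree f \<le> d)"
    using assms
  proof (induction d arbitrary: p)
    case 0
    then obtain c where c: "p = [:c:]"
      using degree_eq_zeroE[of p] by auto
    then have "p = [:sqrt c:]\<^sup>2"
      using 0(1)[of 0] by (simp add: power2_eq_square)
    then show ?case by (intro exI[of _ "[[:sqrt c:]]"]) simp
  next
    case (Suc d)
    obtain r where r: "\<And>t. poly p r \<le> poly p t"
      using nonneg_poly_attains_min[of p] Suc.prems by blast
    define c where "c = poly p r"
    have "0 \<le> poly (p - [:c:]) t" "poly (p - [:c:]) r = 0" for t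
      using r[of t] by (auto simp: c_def)
    then obtain q where q: "p - [:c:] = [:-r, 1:]\<^sup>2 * q" "\<And>t. 0 \<le> poly q t"
      using nonneg_poly_double_root by blast
    have "degree q \<le> 2 * d"
    proof (cases "q = 0")
      case False
      then have "degree (p - [:c:]) = 2 + degree q"
        unfolding q by (subst degree_mult_eq) (auto simp: degree_power_eq)
      moreover have "degree (p - [:c:]) \<le> 2 * Suc d"
        using Suc.prems by (intro degree_diff_le) auto
      ultimately show ?thesis by simp
    qed auto
    then obtain fs where fs: "q = (\<Sum>f\<leftarrow>fs. f\<^sup>2)" "\<forall>f\<in>set fs. degree f \<le> d"
      using Suc.IH q by blast
    have "[:c:] = [:sqrt c:]\<^sup>2"
      using Suc.prems by (simp add: c_def power2_eq_square)
    moreover have "[:-r, 1:]\<^sup>2 * q = (\<Sum>f\<leftarrow>map ((*) [:-r, 1:]) fs. f\<^sup>2)"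
      by (simp add: fs(1) sum_list_const_mult[symmetric] power_mult_distrib o_def del: mult_pCons_left)
    ultimately have "p = (\<Sum>f\<leftarrow>[:sqrt c:] # map ((*) [:-r, 1:]) fs. f\<^sup>2)"
      using q(1) by (simp add: diff_eq_eq)
    moreover have "degree ([:-r, 1:] * f) \<le> Suc d" if "f \<in> set fs" for f
      using that fs(2) degree_mult_le[of "[:-r, 1:]" f] by auto
    ultimately show ?case
      by (intro exI[of _ "[:sqrt c:] # map ((*) [:-r, 1:]) fs"]) auto
  qed
  then show thesis using that by blast
qed

text \<open>Each square \<open>f\<^sup>2\<close> contributes the outer product of the coefficient
  vector of \<open>f\<close> with itself.\<close>

lemma nonneg_poly_gram:
  fixes p :: "real poly"
  assumes "\<And>t. 0 \<le> poly p t" "degree p \<le> 2 * d"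
  obtains G :: "nat \<Rightarrow> nat \<Rightarrow> real"
  where "psd_on {..d} G" "p = (\<Sum>k\<le>d. \<Sum>l\<le>d. monom (G k l) (k + l))" "\<And>k l. G k l = G l k"
proof -
  obtain fs where fs: "p = (\<Sum>f\<leftarrow>fs. f\<^sup>2)" "\<forall>f\<in>set fs. degree f \<le> d"
    using nonneg_poly_sos assms by blast
  define G where "G gs = (\<lambda>k l. \<Sum>f\<leftarrow>gs. coeff f k * coeff f l)" for gs :: "real poly list"
  have "psd_on {..d} (G gs)" for gs
  proof -
    have "0 \<le> (\<Sum>r\<le>d. \<Sum>s\<le>d. z r * G gs r s * z s)" for z
    proof (induction gs)
      case (Cons f gs)
      have "(\<Sum>r\<le>d. \<Sum>s\<le>d. z r * G (f # gs) r s * z s)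
          = (\<Sum>r\<le>d. z r * coeff f r)\<^sup>2 + (\<Sum>r\<le>d. \<Sum>s\<le>d. z r * G gs r s * z s)"
        by (simp add: G_def power2_eq_square sum_product algebra_simps sum.distrib)
      then show ?case using Cons by simp
    qed (simp add: G_def)
    then show ?thesis by (simp add: psd_on_def G_def mult.commute)
  qed
  moreover have "(\<Sum>f\<leftarrow>gs. f\<^sup>2) = (\<Sum>k\<le>d. \<Sum>l\<le>d. monom (G gs k l) (k + l))"
    if "\<forall>f\<in>set gs. degree f \<le> d" for gs
    using that
  proof (induction gs)
    case (Cons f gs)
    then have "f = (\<Sum>k\<le>d. monom (coeff f k) k)"
      by (simp add: poly_as_sum_of_monoms')
    then have "f * f = (\<Sum>k\<le>d. monom (coeff f k) k) * (\<Sum>k\<le>d. monom (coeff f k) k)"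
      by (rule arg_cong2[where f = "(*)"]) (rule \<open>f = _\<close>)+
    then have "f\<^sup>2 = (\<Sum>k\<le>d. \<Sum>l\<le>d. monom (coeff f k * coeff f l) (k + l))"
      by (simp only: power2_eq_square sum_product mult_monom)
    with Cons show ?case
      by (simp add: G_def add_monom[symmetric] sum.distrib)
  qed (simp add: G_def)
  ultimately show thesis
    using that[of "G fs"] fs by (simp add: G_def mult.commute)
qed

section \<open>Growth and convexity of univariate polynomials\<close>

lemma bounded_poly_constant:
  fixes p :: "real poly"
  assumes "\<And>t. 0 \<le> t \<Longrightarrow> \<bar>poly p t\<bar> \<le> C"
  obtains c where "p = [:c:]"
proof (cases p)
  case (pCons a q)
  have "q = 0"
  proof (rule ccontr)
    assume "q \<noteq> 0"
    then obtain r where "\<And>t. r \<le> \<bar>t\<bar> \<Longrightarrow> C + 1 \<le> \<bar>poly p t\<bar>"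
      using poly_infinity[of q "C + 1" a] by (auto simp: pCons)
    from this[of "\<bar>r\<bar>"] assms[of "\<bar>r\<bar>"] show False
      by linarith
  qed
  then show thesis using that pCons by simp
qed

text \<open>This is the chain rule at 0, since coefficients 1 and 2 are the first derivative and
  half the second one.\<close>

lemma coeff_pcompose_line:
  fixes p :: "real poly"
  shows "coeff (pcompose p [:x, h:]) 1 = h * poly (pderiv p) x"
    and "coeff (pcompose p [:x, h:]) 2 = h\<^sup>2 * poly (pderiv (pderiv p)) x / 2"
proof -
  have "coeff P 1 = poly (pderiv P) 0" "coeff P 2 = poly (pderiv (pderiv P)) 0 / 2" for P :: "real poly"
    by (auto simp: poly_0_coeff_0 coeff_pderiv numeral_2_eq_2)
  then show "coeff (pcompose p [:x, h:]) 1 = h * poly (pderiv p) x"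
    and "coeff (pcompose p [:x, h:]) 2 = h\<^sup>2 * poly (pderiv (pderiv p)) x / 2"
    by (simp_all add: pderiv_pcompose poly_pcompose pderiv_pCons pderiv_mult power2_eq_square pderiv_smult)
qed

text \<open>Midpoint convexity between \<open>t\<close> and \<open>-t\<close> makes the
  symmetrization \<open>P(t) = p(t) + p(-t) - 2 p(0)\<close> nonnegative. It vanishes at 0, and its
  coefficient 2 is twice that of \<open>p\<close>.\<close>

lemma convex_poly_coeff_2:
  fixes p :: "real poly"
  assumes "convex_on UNIV (poly p)"
  shows "0 \<le> coeff p 2"
proof -
  define P where "P = p + pcompose p [:0, -1:] - [:2 * poly p 0:]"
  have "0 \<le> poly P t" for t
    using convex_onD[OF assms, of "1/2" t "-t"] by (simp add: P_def poly_pcompose)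
  then have "0 \<le> coeff P 2"
    by (rule nonneg_poly_root_0) (simp add: P_def poly_pcompose)
  then show ?thesis
    by (simp add: P_def coeff_pcompose_linear numeral_2_eq_2)
qed

lemma convex_on_line:
  fixes f :: "'a::real_vector \<Rightarrow> real"
  assumes "convex_on UNIV f" and line: "\<And>t. f (x + t *\<^sub>R h) = g t"
  shows "convex_on UNIV g"
proof (rule convex_onI)
  fix t a b :: real
  assume "0 < t" "t < 1"
  then have "f ((1 - t) *\<^sub>R (x + a *\<^sub>R h) + t *\<^sub>R (x + b *\<^sub>R h)) \<le> (1 - t) * g a + t * g b"
    using convex_onD[OF assms(1), of t "x + a *\<^sub>R h" "x + b *\<^sub>R h"] by (simp add: line)
  moreover have "(1 - t) *\<^sub>R (x + a *\<^sub>R h) + t *\<^sub>R (x + b *\<^sub>R h) = x + ((1 - t) * a + t * b) *\<^sub>R h"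
    by (simp add: algebra_simps)
  ultimately show "g ((1 - t) *\<^sub>R a + t *\<^sub>R b) \<le> (1 - t) * g a + t * g b"
    by (simp add: line)
qed simp

lemma convex_poly_pderiv2:
  fixes p :: "real poly"
  assumes "convex_on UNIV (poly p)"
  shows "0 \<le> poly (pderiv (pderiv p)) x"
proof -
  have "convex_on UNIV (poly (pcompose p [:x, 1:]))"
    by (rule convex_on_line[OF assms, of x 1]) (simp add: poly_pcompose)
  from convex_poly_coeff_2[OF this] show ?thesis
    by (simp add: coeff_pcompose_line)
qed

lemma pderiv2_nonneg_convex:
  fixes p :: "real poly"
  assumes "\<And>x. 0 \<le> poly (pderiv (pderiv p)) x"
  shows "convex_on UNIV (poly p)"
  by (rule f''_ge0_imp_convex[where f' = "poly (pderiv p)" and f'' = "poly (pderiv (pderiv p))"])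
    (auto intro: assms poly_DERIV)

lemma poly_above_tangent:
  fixes p :: "real poly"
  assumes "\<And>x. 0 \<le> poly (pderiv (pderiv p)) x"
  shows "poly p a + poly (pderiv p) a * (t - a) \<le> poly p t"
  using convex_on_imp_above_tangent[OF pderiv2_nonneg_convex[OF assms], of a t "poly (pderiv p) a"]
    poly_DERIV[of p a] by simp

text \<open>Between two zeros convexity forces \<open>p \<le> 0\<close>, hence \<open>p = 0\<close>
  on a whole interval, which is too many roots for a nonzero polynomial.\<close>

lemma nonneg_convex_poly_unique_zero:
  fixes p :: "real poly"
  assumes convex: "\<And>x. 0 \<le> poly (pderiv (pderiv p)) x" and nonneg: "\<And>t. 0 \<le> poly p t"
    and "p \<noteq> 0" "poly p a = 0" "poly p b = 0"
  shows "a = b"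
proof -
  have "a \<le> b" if "poly p a = 0" "poly p b = 0" for a b
  proof (rule ccontr)
    assume "\<not> a \<le> b"
    have "poly p t = 0" if "t \<in> {b..a}" for t
    proof -
      have "poly p ((1 - (t - b) / (a - b)) *\<^sub>R b + ((t - b) / (a - b)) *\<^sub>R a) \<le> 0"
        using convex_onD[OF pderiv2_nonneg_convex[OF convex], of "(t - b) / (a - b)" b a]
          that \<open>poly p a = 0\<close> \<open>poly p b = 0\<close> \<open>\<not> a \<le> b\<close> by (simp add: divide_simps)
      moreover have "(1 - (t - b) / (a - b)) * b + ((t - b) / (a - b)) * a = b + ((t - b) / (a - b)) * (a - b)"
        by (simp only: algebra_simps)
      ultimately show ?thesis
        using nonneg[of t] \<open>\<not> a \<le> b\<close> by simp
    qed
    then have "{b..a} \<subseteq> {t. poly p t = 0}" by auto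
    then have "finite {b..a}"
      using poly_roots_finite[OF \<open>p \<noteq> 0\<close>] finite_subset by blast
    then show False
      using \<open>\<not> a \<le> b\<close> infinite_Icc[of b a] by simp
  qed
  then show ?thesis using assms by (meson antisym)
qed

section \<open>Multivariate polynomials\<close>

lemma lookup_mconst_times [simp]:
  "Poly_Mapping.lookup (mconst c * f) \<mu> = c * Poly_Mapping.lookup f \<mu>"
proof -
  have "mconst c * f = Poly_Mapping.map ((*) c) f"
    by (simp add: mconst_def mult_map_scale_conv_mult)
  then show ?thesis by (simp add: Poly_Mapping.map.rep_eq when_def)
qed

lemma lookup_mconst: "Poly_Mapping.lookup (mconst c) \<mu> = (if \<mu> = 0 then c else 0)"
  by (auto simp: mconst_def lookup_single when_def)

text \<open>The condition says that \<open>\<mu>\<close> is a power of the variable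
  \<open>i\<close>. The monomial 0 satisfies it for every \<open>i\<close>: constants are shared by
  all variables, whereas a nontrivial pure power belongs to one of them.\<close>

lemma lookup_in_var:
  "Poly_Mapping.lookup (in_var i s) \<mu> =
    (if \<mu> = var_pow i (Poly_Mapping.lookup \<mu> i) then coeff s (Poly_Mapping.lookup \<mu> i) else 0)"
proof -
  have "Poly_Mapping.lookup (in_var i s) \<mu> = (\<Sum>k\<le>degree s. if var_pow i k = \<mu> then coeff s k else 0)"
    by (simp add: in_var_def lookup_sum lookup_single when_def)
  also have "\<dots> = (\<Sum>k\<le>degree s. if k = Poly_Mapping.lookup \<mu> i \<and> \<mu> = var_pow i (Poly_Mapping.lookup \<mu> i)
      then coeff s k else 0)"
    by (intro sum.cong) (auto simp: var_pow_def)
  also have "\<dots> = (if \<mu> = var_pow i (Poly_Mapping.lookup \<mu> i) then coeff s (Poly_Mapping.lookup \<mu> i) else 0)"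
    by (cases "\<mu> = var_pow i (Poly_Mapping.lookup \<mu> i)")
      (auto simp: sum.delta coeff_eq_0 intro!: sum.neutral)
  finally show ?thesis .
qed

lemma in_var_add: "in_var i (s + t) = in_var i s + in_var i t"
  by (intro poly_mapping_eqI) (simp add: lookup_in_var lookup_add)

lemma in_var_diff: "in_var i (s - t) = in_var i s - in_var i t"
  by (intro poly_mapping_eqI) (simp add: lookup_in_var lookup_minus)

lemma in_var_0 [simp]: "in_var i 0 = 0"
  by (intro poly_mapping_eqI) (simp add: lookup_in_var)

lemma in_var_const: "in_var i [:c:] = mconst c"
  by (simp add: in_var_def mconst_def var_pow_def)

lemma mono_deg_zero [simp]: "mono_deg 0 = 0"
  by (simp add: mono_deg_def)

lemma mono_deg_add [simp]: "mono_deg (\<alpha> + \<beta>) = mono_deg \<alpha> + mono_deg \<beta>"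
  by (simp add: mono_deg_def lookup_add sum.distrib)

lemma mono_deg_var_pow [simp]: "mono_deg (var_pow i k) = k"
  by (simp add: mono_deg_def var_pow_def lookup_single when_def)

lemma total_degree_le_iff:
  "total_degree f \<le> k \<longleftrightarrow> (\<forall>\<mu>. Poly_Mapping.lookup f \<mu> \<noteq> 0 \<longrightarrow> mono_deg \<mu> \<le> k)"
  by (auto simp: total_degree_def in_keys_iff)

lemma total_degree_add_le:
  "total_degree f \<le> k \<Longrightarrow> total_degree g \<le> k \<Longrightarrow> total_degree (f + g) \<le> k"
  unfolding total_degree_le_iff lookup_add by (metis add_0_left)

lemma total_degree_diff_le:
  "total_degree f \<le> k \<Longrightarrow> total_degree g \<le> k \<Longrightarrow> total_degree (f - g) \<le> k"
  unfolding total_degree_le_iff lookup_minus by (metis diff_0_right)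

lemma total_degree_sum_le:
  "(\<And>i. i \<in> A \<Longrightarrow> total_degree (f i) \<le> k) \<Longrightarrow> total_degree (sum f A) \<le> k"
proof (induction A rule: infinite_finite_induct)
  case (insert x A)
  then show ?case by (simp add: total_degree_add_le)
qed (simp_all add: total_degree_le_iff)

lemma total_degree_mconst_times_le: "total_degree f \<le> k \<Longrightarrow> total_degree (mconst c * f) \<le> k"
  by (simp add: total_degree_le_iff)

lemma total_degree_mconst_le: "total_degree (mconst c) \<le> k"
  by (simp add: total_degree_le_iff lookup_mconst)

lemma total_degree_in_var_le:
  assumes "degree s \<le> k"
  shows "total_degree (in_var i s) \<le> k"
proof -
  have "mono_deg \<mu> \<le> k" if "Poly_Mapping.lookup (in_var i s) \<mu> \<noteq> 0" for \<mu>
  proof -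
    from that have "\<mu> = var_pow i (Poly_Mapping.lookup \<mu> i)" "coeff s (Poly_Mapping.lookup \<mu> i) \<noteq> 0"
      by (auto simp: lookup_in_var split: if_splits)
    then show ?thesis
      using assms le_degree[of s] by (metis mono_deg_var_pow order.trans)
  qed
  then show ?thesis by (simp add: total_degree_le_iff)
qed

section \<open>Evaluation and restriction to lines\<close>

definition mono_eval :: "'n::finite mono \<Rightarrow> real ^ 'n \<Rightarrow> real" where
  "mono_eval \<alpha> x = (\<Prod>i\<in>UNIV. (x $ i) ^ Poly_Mapping.lookup \<alpha> i)"

lemma mono_eval_zero [simp]: "mono_eval 0 x = 1"
  by (simp add: mono_eval_def)

lemma mono_eval_var_pow [simp]: "mono_eval (var_pow i k) x = (x $ i) ^ k"
proof -
  have "mono_eval (var_pow i k) x = (\<Prod>j\<in>UNIV. if j = i then (x $ i) ^ k else 1)"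
    unfolding mono_eval_def by (intro prod.cong) (auto simp: var_pow_def lookup_single when_def)
  then show ?thesis by simp
qed

lemma mono_eval_add: "mono_eval (\<alpha> + \<beta>) x = mono_eval \<alpha> x * mono_eval \<beta> x"
  by (simp add: mono_eval_def lookup_add power_add prod.distrib)

text \<open>Cancellation can make the keys of a sum smaller than those of its summands. Over a
  common finite superset \<open>S\<close> the evaluations can be compared term by term.\<close>

lemma meval_eq_sum:
  assumes "finite S" "Poly_Mapping.keys f \<subseteq> S"
  shows "meval f x = (\<Sum>\<alpha>\<in>S. Poly_Mapping.lookup f \<alpha> * mono_eval \<alpha> x)"
  unfolding meval_def mono_eval_def using assms
  by (intro sum.mono_neutral_left) (auto simp: in_keys_iff)

lemma meval_add [simp]: "meval (f + g) x = meval f x + meval g x"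
proof -
  define S where "S = Poly_Mapping.keys f \<union> Poly_Mapping.keys g"
  have "finite S" "Poly_Mapping.keys f \<subseteq> S" "Poly_Mapping.keys g \<subseteq> S" "Poly_Mapping.keys (f + g) \<subseteq> S"
    using keys_add[of f g] by (auto simp: S_def)
  then show ?thesis
    by (simp add: meval_eq_sum[of S] lookup_add distrib_right sum.distrib)
qed

lemma meval_zero [simp]: "meval 0 x = 0"
  by (simp add: meval_def)

lemma meval_mconst_times [simp]: "meval (mconst c * f) x = c * meval f x"
proof -
  have "Poly_Mapping.keys (mconst c * f) \<subseteq> Poly_Mapping.keys f"
    by (auto simp: in_keys_iff)
  then show ?thesis
    by (simp add: meval_eq_sum[of "Poly_Mapping.keys f"] sum_distrib_left mult.assoc)
qed

lemma meval_uminus [simp]: "meval (- f) x = - meval f x"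
  by (simp add: meval_def sum_negf)

lemma meval_diff [simp]: "meval (f - g) x = meval f x - meval g x"
  using meval_add[of f "- g" x] by simp

lemma meval_sum [simp]: "meval (sum f A) x = (\<Sum>i\<in>A. meval (f i) x)"
  by (induction A rule: infinite_finite_induct) auto

lemma meval_single [simp]: "meval (Poly_Mapping.single \<alpha> c) x = c * mono_eval \<alpha> x"
  by (subst meval_eq_sum[of "{\<alpha>}"]) auto

lemma meval_mconst [simp]: "meval (mconst c) x = c"
  by (simp add: mconst_def)

lemma meval_in_var [simp]: "meval (in_var i s) x = poly s (x $ i)"
  by (simp add: in_var_def poly_altdef)

lemma continuous_on_meval: "continuous_on A (meval f)"
  unfolding meval_def by (intro continuous_intros)

text \<open>Each variable is replaced by a linear polynomial in \<open>t\<close>. This makes the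
  growth of univariate polynomials available along every ray.\<close>

lemma meval_line:
  fixes f :: "'n::finite mpoly"
  obtains P where "\<And>t. meval f (x + t *\<^sub>R h) = poly P t"
proof
  show "meval f (x + t *\<^sub>R h) = poly (\<Sum>\<alpha>\<in>Poly_Mapping.keys f.
      smult (Poly_Mapping.lookup f \<alpha>) (\<Prod>i\<in>UNIV. [:x $ i, h $ i:] ^ Poly_Mapping.lookup \<alpha> i)) t" for t
    by (simp add: meval_def poly_sum poly_prod poly_power)
qed

section \<open>Monomials of low degree and Gram matrices of quadratic polynomials\<close>

lemma mono_split_var:
  assumes "\<mu> \<noteq> 0"
  obtains i \<nu> where "\<mu> = var_pow i 1 + \<nu>"
proof -
  obtain i where i: "Poly_Mapping.lookup \<mu> i \<noteq> 0"
    using assms by (metis poly_mapping_eqI lookup_zero)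
  have "\<mu> = var_pow i 1 + (\<mu> - var_pow i 1)"
    using i by (intro poly_mapping_eqI) (auto simp: lookup_add lookup_minus var_pow_def lookup_single when_def)
  then show thesis by (rule that)
qed

lemma mono_deg_eq_0_iff [simp]: "mono_deg \<alpha> = 0 \<longleftrightarrow> \<alpha> = 0"
proof
  assume "mono_deg \<alpha> = 0"
  show "\<alpha> = 0"
  proof (rule ccontr)
    assume "\<alpha> \<noteq> 0"
    then obtain i \<nu> where "\<alpha> = var_pow i 1 + \<nu>" by (rule mono_split_var)
    with \<open>mono_deg \<alpha> = 0\<close> show False by simp
  qed
qed simp

lemma mono_deg_le_1E:
  assumes "mono_deg \<alpha> \<le> 1"
  obtains "\<alpha> = 0" | i where "\<alpha> = var_pow i 1"
proof (cases "\<alpha> = 0")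
  case False
  then obtain i \<nu> where \<nu>: "\<alpha> = var_pow i 1 + \<nu>" by (rule mono_split_var)
  with assms have "\<nu> = 0" by simp
  with \<nu> that show thesis by simp
qed (use that in auto)

lemma mono_deg_le_1_eq: "{\<alpha>. mono_deg \<alpha> \<le> 1} = insert 0 (range (\<lambda>i. var_pow i 1))"
  by (auto elim: mono_deg_le_1E simp del: One_nat_def)

lemma var_pow_eq_iff: "k \<noteq> 0 \<Longrightarrow> var_pow i k = var_pow j l \<longleftrightarrow> i = j \<and> k = l"
  unfolding var_pow_def by (metis lookup_single_eq lookup_single_not_eq)

lemma sum_mono_deg_le_1:
  fixes F :: "'n::finite mono \<Rightarrow> 'b::comm_monoid_add"
  shows "(\<Sum>\<alpha> | mono_deg \<alpha> \<le> 1. F \<alpha>) = F 0 + (\<Sum>i\<in>UNIV. F (var_pow i 1))"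
proof -
  have "(0 :: 'n mono) \<noteq> var_pow i 1" for i
  proof
    assume "(0 :: 'n mono) = var_pow i 1"
    from arg_cong[OF this, of mono_deg] show False by simp
  qed
  then have "(0 :: 'n mono) \<notin> range (\<lambda>i. var_pow i 1)"
    by blast
  moreover have "inj (\<lambda>i :: 'n. var_pow i 1)"
    by (simp add: inj_def var_pow_eq_iff)
  ultimately show ?thesis
    by (simp add: mono_deg_le_1_eq sum.reindex del: One_nat_def)
qed

lemma mono_deg_le_2E:
  assumes "mono_deg \<mu> \<le> 2"
  obtains \<alpha> \<beta> where "mono_deg \<alpha> \<le> 1" "mono_deg \<beta> \<le> 1" "\<mu> = \<alpha> + \<beta>"
proof (cases "\<mu> = 0")
  case True
  then show thesis using that[of 0 0] by simp
next
  case False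
  then obtain i \<nu> where \<nu>: "\<mu> = var_pow i 1 + \<nu>" by (rule mono_split_var)
  with assms that[of "var_pow i 1" \<nu>] show thesis by simp
qed

text \<open>The variable \<open>\<gamma>\<close> occurs in the product, hence in one of the factors,
  and a factor of degree at most 1 containing it is equal to it.\<close>

lemma mono_deg_le_1_sum_cancel:
  assumes "mono_deg \<gamma> \<le> 1" "mono_deg \<alpha> \<le> 1" "mono_deg \<beta> \<le> 1" "\<gamma> \<noteq> 0" "\<gamma> + \<delta> = \<alpha> + \<beta>"
  shows "\<alpha> = \<gamma> \<or> \<beta> = \<gamma>"
proof -
  obtain i where i: "\<gamma> = var_pow i 1"
    using assms(1,4) by (auto elim: mono_deg_le_1E simp del: One_nat_def)
  have eq: "\<epsilon> = \<gamma>" if "mono_deg \<epsilon> \<le> 1" "Poly_Mapping.lookup \<epsilon> i \<noteq> 0" for \<epsilon>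
    using that i by (cases rule: mono_deg_le_1E[OF that(1)]) (auto simp: var_pow_def lookup_single when_def split: if_splits)
  have "Poly_Mapping.lookup (\<alpha> + \<beta>) i \<noteq> 0"
    by (simp add: assms(5)[symmetric] i lookup_add var_pow_def)
  then show ?thesis
    using eq assms by (auto simp: lookup_add)
qed

text \<open>Factorization into two monomials of degree at most 1 is unique up to order, so a
  coefficient of a quadratic polynomial meets only one unordered pair of Gram indices.\<close>

lemma mono_deg_le_1_sum_eq:
  assumes deg: "mono_deg \<alpha> \<le> 1" "mono_deg \<beta> \<le> 1" "mono_deg \<alpha>' \<le> 1" "mono_deg \<beta>' \<le> 1"
    and eq: "\<alpha>' + \<beta>' = \<alpha> + \<beta>"
  shows "\<alpha>' = \<alpha> \<and> \<beta>' = \<beta> \<or> \<alpha>' = \<beta> \<and> \<beta>' = \<alpha>"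
proof (cases "\<alpha> = 0 \<and> \<beta> = 0")
  case True
  then have "mono_deg (\<alpha>' + \<beta>') = 0" by (simp add: eq)
  with True show ?thesis by simp
next
  case False
  then consider "\<alpha> \<noteq> 0" | "\<beta> \<noteq> 0" by blast
  then show ?thesis
  proof cases
    case 1
    from mono_deg_le_1_sum_cancel[OF deg(1,3,4) 1 eq[symmetric]] eq show ?thesis
      by (metis add.commute add_left_cancel)
  next
    case 2
    from mono_deg_le_1_sum_cancel[OF deg(2,3,4) 2, of \<alpha>] eq show ?thesis
      by (metis add.commute add_left_cancel)
  qed
qed

text \<open>The symmetric matrix of a quadratic polynomial in the basis of 1 and the variables. An
  off-diagonal coefficient is shared by two entries, hence the divisor 2.\<close>

definition quad_gram :: "'n::finite mpoly \<Rightarrow> 'n mono \<Rightarrow> 'n mono \<Rightarrow> real" where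
  "quad_gram q \<alpha> \<beta> = Poly_Mapping.lookup q (\<alpha> + \<beta>) / (if \<alpha> = \<beta> then 1 else 2)"

lemma quad_gram_commute: "quad_gram q \<alpha> \<beta> = quad_gram q \<beta> \<alpha>"
  by (simp add: quad_gram_def add.commute)

lemma quad_gram_sum:
  fixes q :: "'n::finite mpoly"
  assumes "quadratic q"
  shows "(\<Sum>\<alpha> | mono_deg \<alpha> \<le> 1. \<Sum>\<beta> | mono_deg \<beta> \<le> 1.
    Poly_Mapping.single (\<alpha> + \<beta>) (quad_gram q \<alpha> \<beta>)) = q" (is "?S = q")
proof (rule poly_mapping_eqI)
  fix \<mu> :: "'n mono"
  define B where "B = {\<alpha> :: 'n mono. mono_deg \<alpha> \<le> 1}"
  have fin: "finite B" by (simp add: B_def mono_deg_le_1_eq del: One_nat_def)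
  have S: "Poly_Mapping.lookup ?S \<mu> =
      (\<Sum>(\<alpha>, \<beta>)\<in>B \<times> B. if \<alpha> + \<beta> = \<mu> then quad_gram q \<alpha> \<beta> else 0)"
    by (simp add: B_def lookup_sum lookup_single when_def sum.cartesian_product[symmetric])
  show "Poly_Mapping.lookup ?S \<mu> = Poly_Mapping.lookup q \<mu>"
  proof (cases "mono_deg \<mu> \<le> 2")
    case True
    then obtain \<alpha> \<beta> where ab: "\<alpha> \<in> B" "\<beta> \<in> B" "\<mu> = \<alpha> + \<beta>"
      unfolding B_def by (auto elim: mono_deg_le_2E)
    \<comment> \<open>For \<open>\<alpha> = \<beta>\<close> the index set collapses to one element,
      which matches the divisor 1 in \<open>quad_gram\<close>.\<close>
    have "Poly_Mapping.lookup ?S \<mu> = (\<Sum>(\<alpha>, \<beta>)\<in>{(\<alpha>, \<beta>), (\<beta>, \<alpha>)}. quad_gram q \<alpha> \<beta>)"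
      unfolding S
    proof (intro sum.mono_neutral_cong_right ballI)
      show "(case x of (\<alpha>, \<beta>) \<Rightarrow> if \<alpha> + \<beta> = \<mu> then quad_gram q \<alpha> \<beta> else 0) = 0"
        if "x \<in> B \<times> B - {(\<alpha>, \<beta>), (\<beta>, \<alpha>)}" for x
        using that ab mono_deg_le_1_sum_eq[of \<alpha> \<beta> "fst x" "snd x"] by (auto simp: B_def split: if_splits)
    qed (use fin ab in \<open>auto simp: add.commute\<close>)
    then show ?thesis
      using ab by (cases "\<alpha> = \<beta>") (auto simp: quad_gram_def add.commute)
  next
    case False
    have "(\<Sum>(\<alpha>, \<beta>)\<in>B \<times> B. if \<alpha> + \<beta> = \<mu> then quad_gram q \<alpha> \<beta> else 0) = 0"
      using False by (intro sum.neutral) (auto simp: B_def)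
    moreover have "Poly_Mapping.lookup q \<mu> = 0"
      using assms False unfolding quadratic_def total_degree_le_iff by blast
    ultimately show ?thesis unfolding S by simp
  qed
qed

lemma meval_quad_gram:
  assumes "quadratic q"
  shows "meval q x = (\<Sum>\<alpha> | mono_deg \<alpha> \<le> 1. \<Sum>\<beta> | mono_deg \<beta> \<le> 1.
    mono_eval \<alpha> x * quad_gram q \<alpha> \<beta> * mono_eval \<beta> x)"
  by (subst quad_gram_sum[OF assms, symmetric]) (simp add: mono_eval_add mult_ac)

text \<open>For quadratic \<open>q\<close> this is the homogeneous part of degree 2, that is, half
  the second derivative in direction \<open>h\<close>: the even part of \<open>q\<close> minus its
  constant term. Written through values of \<open>q\<close>, it is visibly additive in
  \<open>q\<close>.\<close>

definition quad_form :: "'n::finite mpoly \<Rightarrow> real ^ 'n \<Rightarrow> real" where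
  "quad_form q h = (meval q h + meval q (- h)) / 2 - meval q 0"

lemma quadratic_line:
  fixes q :: "'n::finite mpoly"
  assumes "quadratic q"
  obtains b where "\<And>t. meval q (x + t *\<^sub>R h) = meval q x + b * t + quad_form q h * t\<^sup>2"
proof -
  define c where "c = quad_gram q 0 0"
  define l where "l i = quad_gram q 0 (var_pow i 1) + quad_gram q (var_pow i 1) 0" for i
  define A where "A i j = quad_gram q (var_pow i 1) (var_pow j 1)" for i j
  have q: "meval q x = c + (\<Sum>i\<in>UNIV. l i * x $ i) + (\<Sum>i\<in>UNIV. \<Sum>j\<in>UNIV. A i j * (x $ i * x $ j))" for x
    by (simp add: meval_quad_gram[OF assms] sum_mono_deg_le_1[unfolded One_nat_def] c_def l_def A_def algebra_simps sum.distrib)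
  have form: "quad_form q h = (\<Sum>i\<in>UNIV. \<Sum>j\<in>UNIV. A i j * (h $ i * h $ j))"
    by (simp add: quad_form_def q sum_negf add_divide_distrib)
  define b where "b = (\<Sum>i\<in>UNIV. l i * h $ i) + (\<Sum>i\<in>UNIV. \<Sum>j\<in>UNIV. A i j * (x $ i * h $ j + h $ i * x $ j))"
  have "meval q (x + t *\<^sub>R h) = meval q x + b * t + quad_form q h * t\<^sup>2" for t
    by (simp add: q form b_def algebra_simps sum.distrib sum_distrib_left power2_eq_square)
  then show thesis by (rule that)
qed

text \<open>Homogenization: a test vector with \<open>z 0 \<noteq> 0\<close> is \<open>z 0\<close>
  times the monomial vector of a point \<open>x\<close>, so the form has the value
  \<open>(z 0)\<^sup>2 * meval q x\<close>.\<close>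

lemma nonneg_quadratic_gram_psd:
  fixes q :: "'n::finite mpoly"
  assumes q: "quadratic q" "nonneg q"
  shows "psd_on {\<alpha>. mono_deg \<alpha> \<le> 1} (quad_gram q)"
proof -
  define F where "F z = (\<Sum>\<alpha> | mono_deg \<alpha> \<le> 1. \<Sum>\<beta> | mono_deg \<beta> \<le> 1. z \<alpha> * quad_gram q \<alpha> \<beta> * z \<beta>)" for z
  have pos: "0 \<le> F z" if "z 0 \<noteq> 0" for z
  proof -
    define x :: "real ^ 'n" where "x = (\<chi> i. z (var_pow i 1) / z 0)"
    have z: "z \<alpha> = z 0 * mono_eval \<alpha> x" if "mono_deg \<alpha> \<le> 1" for \<alpha>
      using that \<open>z 0 \<noteq> 0\<close> by (cases rule: mono_deg_le_1E) (auto simp: x_def)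
    have "F z = (\<Sum>\<alpha> | mono_deg \<alpha> \<le> 1. \<Sum>\<beta> | mono_deg \<beta> \<le> 1.
        (z 0)\<^sup>2 * (mono_eval \<alpha> x * quad_gram q \<alpha> \<beta> * mono_eval \<beta> x))"
      unfolding F_def
    proof (intro sum.cong refl)
      fix \<alpha> \<beta> :: "'n mono" assume "\<alpha> \<in> {\<alpha>. mono_deg \<alpha> \<le> 1}" "\<beta> \<in> {\<alpha>. mono_deg \<alpha> \<le> 1}"
      then show "z \<alpha> * quad_gram q \<alpha> \<beta> * z \<beta> = (z 0)\<^sup>2 * (mono_eval \<alpha> x * quad_gram q \<alpha> \<beta> * mono_eval \<beta> x)"
        using z[of \<alpha>] z[of \<beta>] by (simp add: power2_eq_square)
    qed
    also have "\<dots> = (z 0)\<^sup>2 * meval q x"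
      by (simp add: meval_quad_gram[OF q(1)] sum_distrib_left)
    finally show ?thesis
      using q(2) by (simp add: nonneg_def)
  qed
  have "0 \<le> F z" for z
  proof (cases "z 0 = 0")
    case True
    \<comment> \<open>Vectors with \<open>z 0 = 0\<close> correspond to points at infinity and are
      reached as limits of vectors with nonzero entry \<open>\<epsilon>\<close>.\<close>
    have "((\<lambda>\<epsilon>. (z(0 := \<epsilon>)) \<alpha>) \<longlongrightarrow> z \<alpha>) (at 0)" for \<alpha>
      using True by (cases "\<alpha> = 0") auto
    then have "((\<lambda>\<epsilon>. F (z(0 := \<epsilon>))) \<longlongrightarrow> F z) (at 0)"
      unfolding F_def by (intro tendsto_intros)
    then show ?thesis
      by (rule tendsto_lowerbound) (auto simp: eventually_at intro!: pos exI[of _ 1])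
  qed (rule pos)
  then show ?thesis
    by (auto simp: psd_on_def F_def quad_gram_commute)
qed

section \<open>Convex minimization and Lagrange multipliers\<close>

text \<open>Normalized points of \<open>S\<close> escaping to infinity accumulate at a unit vector
  \<open>d\<close>. By convexity the segments from 0 to these points stay in the sublevel set, and
  every point of the ray along \<open>d\<close> is a limit of points on such segments. The subspace
  \<open>M\<close>, being closed, keeps the limit.\<close>

lemma convex_sublevel_ray:
  fixes f :: "'a::euclidean_space \<Rightarrow> real"
  assumes convex: "convex_on UNIV f" and cont: "continuous_on UNIV f"
    and "subspace M" "S \<subseteq> M" "\<not> bounded S" and sub: "\<And>x. x \<in> S \<Longrightarrow> f x \<le> C" and "f 0 \<le> C"
  obtains d where "d \<in> M" "norm d = 1" "\<And>t. 0 \<le> t \<Longrightarrow> f (t *\<^sub>R d) \<le> C"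
proof -
  have "\<exists>x\<in>S. real n < norm x" for n
    using \<open>\<not> bounded S\<close> by (meson bounded_iff not_le)
  then obtain x where x: "\<And>n. x n \<in> S" "\<And>n. real n < norm (x n)"
    by metis
  define v where "v n = x n /\<^sub>R norm (x n)" for n
  have "norm (x n) \<noteq> 0" for n
    using x(2)[of n] by linarith
  then have v: "v n \<in> sphere 0 1 \<inter> M" for n
    using x(1)[of n] assms(3,4) by (auto simp: v_def subspace_scale)
  have "compact (sphere (0 :: 'a) 1 \<inter> M)"
    using \<open>subspace M\<close> by (intro compact_Int_closed closed_subspace) auto
  then obtain d r where d: "d \<in> sphere 0 1 \<inter> M" "strict_mono r" "(v \<circ> r) \<longlonglongrightarrow> d"
    using v unfolding compact_def by meson
  have "f (t *\<^sub>R d) \<le> C" if "0 \<le> t" for t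
  proof -
    \<comment> \<open>As \<open>norm (x n) > n \<ge> t\<close>, the point lies on the segment from 0
      to \<open>x n\<close>.\<close>
    have bound: "f (t *\<^sub>R v n) \<le> C" if "t \<le> real n" for n
    proof -
      define s where "s = t / norm (x n)"
      have s: "0 \<le> s" "s \<le> 1"
        using x(2)[of n] that \<open>0 \<le> t\<close> by (auto simp: s_def divide_simps)
      have "f (t *\<^sub>R v n) = f ((1 - s) *\<^sub>R 0 + s *\<^sub>R x n)"
        by (simp add: s_def v_def divide_inverse)
      also have "\<dots> \<le> (1 - s) * f 0 + s * f (x n)"
        using convex_onD[OF convex s] by blast
      also have "\<dots> \<le> (1 - s) * C + s * C"
        using s sub[OF x(1)[of n]] \<open>f 0 \<le> C\<close> by (intro add_mono mult_left_mono) auto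
      finally show ?thesis by (simp add: algebra_simps)
    qed
    have "(\<lambda>n. t *\<^sub>R v (r n)) \<longlonglongrightarrow> t *\<^sub>R d"
      using d(3) by (intro tendsto_intros) (simp add: o_def)
    then have "(\<lambda>n. f (t *\<^sub>R v (r n))) \<longlonglongrightarrow> f (t *\<^sub>R d)"
      using cont by (metis continuous_on_tendsto_compose UNIV_I eventually_sequentiallyI)
    moreover have "\<forall>n\<ge>nat \<lceil>t\<rceil>. f (t *\<^sub>R v (r n)) \<le> C"
    proof (intro allI impI bound)
      fix n assume "nat \<lceil>t\<rceil> \<le> n"
      moreover have "n \<le> r n" using d(2) by (rule strict_mono_imp_increasing)
      ultimately show "t \<le> real (r n)" by linarith
    qed
    ultimately show ?thesis by (meson LIMSEQ_le_const2)
  qed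
  then show thesis using d that by auto
qed

text \<open>The point \<open>x + t d\<close> is the limit for \<open>s \<rightarrow> 0\<close> of
  convex combinations of \<open>x\<close> and the far point \<open>(t / s) d\<close>, where
  \<open>f\<close> is at most \<open>C\<close>. Hence \<open>f\<close> does not exceed
  \<open>f x\<close> on the ray from \<open>x\<close>, and a polynomial bounded on a ray is constant
  on its whole line.\<close>

lemma convex_constant_direction:
  fixes f :: "'a::euclidean_space \<Rightarrow> real"
  assumes convex: "convex_on UNIV f" and cont: "continuous_on UNIV f"
    and line: "\<And>x h. \<exists>P. \<forall>t. f (x + t *\<^sub>R h) = poly P t"
    and below: "\<And>x. c \<le> f x" and above: "\<And>t. 0 \<le> t \<Longrightarrow> f (t *\<^sub>R d) \<le> C"
  shows "f (x + t *\<^sub>R d) = f x"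
proof -
  have le: "f (x + t *\<^sub>R d) \<le> f x" if "0 \<le> t" for t
  proof -
    have "((\<lambda>s. (1 - s) *\<^sub>R x + t *\<^sub>R d) \<longlongrightarrow> (1 - 0) *\<^sub>R x + t *\<^sub>R d) (at_right 0)"
      by (intro tendsto_intros)
    then have "((\<lambda>s. f ((1 - s) *\<^sub>R x + t *\<^sub>R d)) \<longlongrightarrow> f (x + t *\<^sub>R d)) (at_right 0)"
      using continuous_on_tendsto_compose[OF cont] by auto
    moreover have "((\<lambda>s. (1 - s) * f x + s * C) \<longlongrightarrow> (1 - 0) * f x + 0 * C) (at_right 0)"
      by (intro tendsto_intros)
    moreover have "\<forall>\<^sub>F s in at_right (0 :: real). f ((1 - s) *\<^sub>R x + t *\<^sub>R d) \<le> (1 - s) * f x + s * C"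
    proof -
      have "f ((1 - s) *\<^sub>R x + t *\<^sub>R d) \<le> (1 - s) * f x + s * C" if "0 < s" "s < 1" for s :: real
      proof -
        have "f ((1 - s) *\<^sub>R x + s *\<^sub>R ((t / s) *\<^sub>R d)) \<le> (1 - s) * f x + s * f ((t / s) *\<^sub>R d)"
          using that by (intro convex_onD[OF convex]) auto
        moreover have "s * f ((t / s) *\<^sub>R d) \<le> s * C"
          using that \<open>0 \<le> t\<close> above by simp
        moreover have "s *\<^sub>R ((t / s) *\<^sub>R d) = t *\<^sub>R d"
          using that by simp
        ultimately show ?thesis by (metis add_left_mono order.trans)
      qed
      then show ?thesis
        unfolding eventually_at_right_field by (auto intro!: exI[of _ 1])
    qed
    ultimately show ?thesis
      using tendsto_le[OF trivial_limit_at_right_real] by fastforce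
  qed
  obtain P where P: "\<And>t. f (x + t *\<^sub>R d) = poly P t"
    using line by blast
  have "\<bar>poly P t\<bar> \<le> \<bar>c\<bar> + \<bar>f x\<bar>" if "0 \<le> t" for t
    using le[OF that] below[of "x + t *\<^sub>R d"] by (simp add: P)
  then obtain k where "P = [:k:]"
    using bounded_poly_constant by blast
  with P[of 0] P[of t] show ?thesis by simp
qed

text \<open>Modulo the subspace of directions along which \<open>f\<close> is constant, the sublevel sets are compact.\<close>

lemma convex_polynomial_attains_min:
  fixes f :: "'a::euclidean_space \<Rightarrow> real"
  assumes convex: "convex_on UNIV f" and cont: "continuous_on UNIV f"
    and line: "\<And>x h. \<exists>P. \<forall>t. f (x + t *\<^sub>R h) = poly P t"
    and below: "\<And>x. c \<le> f x"
  obtains x where "\<And>y. f x \<le> f y"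
proof -
  define L where "L = {d. \<forall>x t. f (x + t *\<^sub>R d) = f x}"
  have L: "subspace L"
    unfolding subspace_def
  proof (intro conjI ballI allI)
    show "0 \<in> L" by (simp add: L_def)
    fix d e assume "d \<in> L" "e \<in> L"
    then have "f (x + t *\<^sub>R (d + e)) = f x" for x t
      by (simp add: L_def scaleR_add_right add.assoc[symmetric])
    then show "d + e \<in> L" by (simp add: L_def)
  next
    fix d k assume "d \<in> L"
    then show "k *\<^sub>R d \<in> L" by (simp add: L_def)
  qed
  define M where "M = {z. \<forall>w\<in>L. orthogonal w z}"
  have M: "subspace M"
    unfolding M_def by (rule subspace_orthogonal_to_vectors)
  define S where "S = M \<inter> {z. f z \<le> f 0}"
  have "bounded S"
  proof (rule ccontr)
    assume unbounded: "\<not> bounded S"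
    \<comment> \<open>Such a ray is a direction of constancy, so \<open>d\<close> lies in
      \<open>L\<close> as well as in its orthogonal complement \<open>M\<close>, which is impossible
      for a unit vector.\<close>
    obtain d where d: "d \<in> M" "norm d = 1" "\<And>t. 0 \<le> t \<Longrightarrow> f (t *\<^sub>R d) \<le> f 0"
      by (rule convex_sublevel_ray[OF convex cont M _ unbounded, of "f 0"]) (auto simp: S_def)
    have "d \<in> L"
      using convex_constant_direction[OF convex cont line below d(3)] by (simp add: L_def)
    then have "orthogonal d d" using d(1) by (simp add: M_def)
    then show False using d(2) by (auto simp: orthogonal_self)
  qed
  moreover have "closed S"
    unfolding S_def by (intro closed_Int closed_subspace M closed_Collect_le cont continuous_intros)
  ultimately have "compact S" by (simp add: compact_eq_bounded_closed)
  moreover have "0 \<in> S" using M by (simp add: S_def subspace_0)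
  ultimately obtain z where z: "z \<in> S" "\<And>y. y \<in> S \<Longrightarrow> f z \<le> f y"
    using continuous_attains_inf[of S f] cont by (metis continuous_on_subset empty_iff subset_UNIV)
  have "f z \<le> f y" for y
  proof -
    \<comment> \<open>Dropping the component in \<open>L\<close> does not change \<open>f\<close>,
      so every value of \<open>f\<close> is taken on \<open>M\<close>.\<close>
    obtain l m where lm: "l \<in> span L" "\<And>w. w \<in> span L \<Longrightarrow> orthogonal m w" "y = l + m"
      using orthogonal_subspace_decomp_exists by blast
    have "l \<in> L" using lm(1) L span_eq_iff by blast
    then have "f (m + 1 *\<^sub>R l) = f m" unfolding L_def by blast
    then have "f y = f m" by (simp add: lm(3) add.commute)
    moreover have "m \<in> M"
      using lm(2) by (auto simp: M_def span_base orthogonal_commute)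
    ultimately show ?thesis
      using z(2)[of m] z(2)[OF \<open>0 \<in> S\<close>] by (cases "f m \<le> f 0") (auto simp: S_def)
  qed
  then show thesis by (rule that)
qed

section \<open>Strict convexity and compact sublevel sets\<close>

lemma strictly_convex_imp_convex_on:
  assumes "strictly_convex f"
  shows "convex_on UNIV f"
proof (rule convex_onI)
  fix t :: real and x y
  assume "0 < t" "t < 1"
  with assms   show "f ((1 - t) *\<^sub>R x + t *\<^sub>R y) \<le> (1 - t) * f x + t * f y"
    by (cases "x = y") (auto simp: strictly_convex_def scaleR_left_distrib[symmetric] algebra_simps less_imp_le)
qed simp

text \<open>An unbounded sublevel set contains a ray up to enlarging the level. There
  \<open>f\<close> is a convex polynomial bounded above, so its derivative is increasing and nowhere
  positive; being bounded on the half-line, the derivative is constant. Then \<open>f\<close> is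
  affine on a line, against strict convexity.\<close>

lemma strictly_convex_bounded_sublevel:
  fixes f :: "'a::euclidean_space \<Rightarrow> real"
  assumes strict: "strictly_convex f" and cont: "continuous_on UNIV f"
    and line: "\<And>x h. \<exists>P. \<forall>t. f (x + t *\<^sub>R h) = poly P t"
  shows "bounded {x. f x \<le> C}"
proof (rule ccontr)
  assume unbounded: "\<not> bounded {x. f x \<le> C}"
  \<comment> \<open>The maximum puts 0 into the sublevel set, as the ray has to start there.\<close>
  define C' where "C' = max C (f 0)"
  have convex: "convex_on UNIV f"
    using strict by (rule strictly_convex_imp_convex_on)
  obtain d where d: "norm d = 1" "\<And>t. 0 \<le> t \<Longrightarrow> f (t *\<^sub>R d) \<le> C'"
    by (rule convex_sublevel_ray[OF convex cont subspace_UNIV subset_UNIV unbounded, of C'])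
      (auto simp: C'_def)
  obtain P where P: "\<And>t. f (t *\<^sub>R d) = poly P t"
    using line[of 0 d] by auto
  have "convex_on UNIV (poly P)"
    by (rule convex_on_line[OF convex, of 0 d]) (simp add: P)
  note P2 = convex_poly_pderiv2[OF this]
  have neg: "poly (pderiv P) a \<le> 0" for a
  proof (rule ccontr)
    define s where "s = poly (pderiv P) a"
    assume "\<not> poly (pderiv P) a \<le> 0"
    then have "0 < s" by (simp add: s_def)
    \<comment> \<open>With positive slope \<open>s\<close> the tangent at \<open>a\<close> rises by
      at least \<open>K\<close> up to \<open>t\<close>, and so exceeds \<open>C'\<close>.\<close>
    define K where "K = \<bar>C'\<bar> + 1 + \<bar>poly P a\<bar>"
    define t where "t = \<bar>a\<bar> + K / s"
    have "0 \<le> K / s"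
      using \<open>0 < s\<close> by (simp add: K_def)
    then have "0 \<le> t" unfolding t_def by linarith
    have "s * (K / s) \<le> s * (t - a)"
      using \<open>0 < s\<close> by (intro mult_left_mono) (auto simp: t_def)
    then have "K \<le> s * (t - a)"
      using \<open>0 < s\<close> by simp
    moreover have "poly P a + s * (t - a) \<le> C'"
      using poly_above_tangent[OF P2, of a t] d(2)[OF \<open>0 \<le> t\<close>] by (simp add: P s_def)
    ultimately have "poly P a + K \<le> C'" by (metis add_left_mono order.trans)
    then show False unfolding K_def by linarith
  qed
  have "\<bar>poly (pderiv P) t\<bar> \<le> \<bar>poly (pderiv P) 0\<bar>" if "0 \<le> t" for t
  proof -
    have "poly (pderiv P) 0 \<le> poly (pderiv P) t"
      using that by (rule DERIV_nonneg_imp_nondecreasing) (use P2 poly_DERIV in blast)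
    then show ?thesis using neg[of t] by linarith
  qed
  then obtain k where "pderiv P = [:k:]"
    using bounded_poly_constant by blast
  then have "pderiv (P - [:0, k:]) = 0"
    by (simp add: pderiv_diff pderiv_pCons)
  then obtain l where "P - [:0, k:] = [:l:]"
    using degree_eq_zeroE by (auto simp: pderiv_eq_0_iff)
  then have "P = [:0, k:] + [:l:]"
    by (simp only: diff_eq_eq add.commute)
  then have "poly P t = l + k * t" for t by simp
  moreover have "d \<noteq> 0" using d(1) by auto
  then have "f ((1 - 1/2) *\<^sub>R 0 + (1/2) *\<^sub>R (2 *\<^sub>R d)) < (1 - 1/2) * f 0 + (1/2) * f (2 *\<^sub>R d)"
    using strict[unfolded strictly_convex_def, rule_format, of 0 "2 *\<^sub>R d" "1/2"] by simp
  ultimately show False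
    using P[of 0] P[of 1] P[of 2] by (simp add: add_divide_distrib)
qed

text \<open>Points with \<open>h x > 0\<close> bound the multiplier from below, points with
  \<open>h x < 0\<close> bound it from above. No lower bound exceeds an upper one, so the supremum
  of the lower bounds works; the strictly feasible point \<open>z\<close> makes it finite.\<close>

lemma lagrange_multiplier:
  fixes f h :: "'a::real_vector \<Rightarrow> real"
  assumes f: "convex_on X f" and h: "convex_on X h" and z: "z \<in> X" "h z < 0"
    and c: "\<And>x. x \<in> X \<Longrightarrow> h x \<le> 0 \<Longrightarrow> c \<le> f x"
  obtains y where "0 \<le> y" "\<And>x. x \<in> X \<Longrightarrow> c \<le> f x + y * h x"
proof -
  have key: "(c - f x1) / h x1 \<le> (f x2 - c) / (- h x2)"
    if x: "x1 \<in> X" "x2 \<in> X" "0 < h x1" "h x2 < 0" for x1 x2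
  proof -
    \<comment> \<open>The weight at which the linear interpolation between \<open>h x1\<close> and
      \<open>h x2\<close> vanishes; by convexity of \<open>h\<close> the combined point is
      feasible.\<close>
    define s where "s = h x1 / (h x1 - h x2)"
    have s: "0 \<le> s" "s \<le> 1"
      using x by (auto simp: s_def divide_simps)
    have *: "(1 - s) * a1 + s * a2 = (- h x2 * a1 + h x1 * a2) / (h x1 - h x2)" for a1 a2
      using x by (simp add: s_def divide_simps)
    have X: "(1 - s) *\<^sub>R x1 + s *\<^sub>R x2 \<in> X"
      using convex_on_imp_convex[OF f] s x by (simp add: convex_alt)
    have "h ((1 - s) *\<^sub>R x1 + s *\<^sub>R x2) \<le> (1 - s) * h x1 + s * h x2"
      using convex_onD[OF h s x(1,2)] .
    then have "h ((1 - s) *\<^sub>R x1 + s *\<^sub>R x2) \<le> 0"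
      by (simp add: *)
    then have "c \<le> f ((1 - s) *\<^sub>R x1 + s *\<^sub>R x2)"
      by (rule c[OF X])
    also have "\<dots> \<le> (1 - s) * f x1 + s * f x2"
      using convex_onD[OF f s x(1,2)] .
    finally have "c * (h x1 - h x2) \<le> - h x2 * f x1 + h x1 * f x2"
      using x by (simp add: * divide_simps)
    then show ?thesis
      using x by (simp add: divide_simps; simp add: algebra_simps)
  qed
  \<comment> \<open>Inserting 0 makes the set nonempty and its supremum nonnegative.\<close>
  define A where "A = insert 0 ((\<lambda>x. (c - f x) / h x) ` {x\<in>X. 0 < h x})"
  have le: "a \<le> (f x - c) / (- h x)" if "a \<in> A" "x \<in> X" "h x < 0" for a x
    using that c[of x] key[of _ x] by (auto simp: A_def divide_simps)
  then have bdd: "bdd_above A"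
    using z by (meson bdd_aboveI)
  define y where "y = Sup A"
  have "0 \<le> y"
    unfolding y_def by (rule cSup_upper[OF _ bdd]) (simp add: A_def)
  moreover have "c \<le> f x + y * h x" if x: "x \<in> X" for x
  proof (cases "h x" "0 :: real" rule: linorder_cases)
    case less
    have "y \<le> (f x - c) / (- h x)"
      unfolding y_def by (rule cSup_least) (use le x less in \<open>auto simp: A_def\<close>)
    then show ?thesis using less by (simp add: divide_simps; simp add: algebra_simps)
  next
    case equal
    then show ?thesis using c[OF x] by simp
  next
    case greater
    have "(c - f x) / h x \<le> y"
      unfolding y_def by (rule cSup_upper[OF _ bdd]) (use x greater in \<open>auto simp: A_def\<close>)
    then show ?thesis using greater by (simp add: divide_simps; simp add: algebra_simps)
  qed
  ultimately show thesis by (rule that)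
qed

text \<open>The constraints are dualized one at a time, the remaining ones restricting the domain.\<close>

lemma lagrange_multipliers:
  fixes f :: "'a::real_vector \<Rightarrow> real" and h :: "nat \<Rightarrow> 'a \<Rightarrow> real"
  assumes "convex_on UNIV f" "\<And>i. i < m \<Longrightarrow> convex_on UNIV (h i)"
    and "\<And>i. i < m \<Longrightarrow> h i z < 0"
    and "\<And>x. (\<And>i. i < m \<Longrightarrow> h i x \<le> 0) \<Longrightarrow> c \<le> f x"
  obtains y where "\<And>i. 0 \<le> y i" "\<And>x. c \<le> f x + (\<Sum>i<m. y i * h i x)"
proof -
  have "\<exists>y. (\<forall>i. 0 \<le> y i) \<and> (\<forall>x. c \<le> f x + (\<Sum>i<m. y i * h i x))"
    using assms
  \<comment> \<open>The induction hypothesis is applied to \<open>f + k h_m\<close>, where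
    \<open>k \<ge> 0\<close> is the multiplier of the last constraint on the domain cut out by the
    others.\<close>
  proof (induction m arbitrary: f)
    case 0
    then show ?case by (intro exI[of _ "\<lambda>_. 0"]) simp
  next
    case (Suc m)
    define X where "X = {x. \<forall>i<m. h i x \<le> 0}"
    have "convex {x. h i x \<le> 0}" if "i < m" for i
    proof (rule convexI)
      fix x y :: 'a and u v :: real
      assume "x \<in> {x. h i x \<le> 0}" "y \<in> {x. h i x \<le> 0}" "0 \<le> u" "0 \<le> v" "u + v = 1"
      moreover from this have "u * h i x + v * h i y \<le> 0"
        by (simp add: add_nonpos_nonpos mult_nonneg_nonpos)
      moreover have "convex_on UNIV (h i)" using Suc.prems(2) that by simp
      ultimately show "u *\<^sub>R x + v *\<^sub>R y \<in> {x. h i x \<le> 0}"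
        unfolding convex_on_def by (metis (mono_tags) UNIV_I mem_Collect_eq order.trans)
    qed
    moreover have "X = (\<Inter>i<m. {x. h i x \<le> 0})"
      by (auto simp: X_def)
    ultimately have "convex X"
      by (metis (no_types, lifting) convex_INT lessThan_iff)
    then have "convex_on X f" "convex_on X (h m)"
      using Suc.prems(1) Suc.prems(2)[of m] convex_on_subset[of UNIV] by auto
    moreover have "z \<in> X" "h m z < 0"
      using Suc.prems(3) by (auto simp: X_def less_imp_le)
    moreover have "c \<le> f x" if "x \<in> X" "h m x \<le> 0" for x
      using Suc.prems(4) that by (auto simp: X_def less_Suc_eq)
    ultimately obtain k where k: "0 \<le> k" "\<And>x. x \<in> X \<Longrightarrow> c \<le> f x + k * h m x"
      using lagrange_multiplier[of X f "h m" z c] by metis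
    have "convex_on UNIV (\<lambda>x. f x + k * h m x)"
      using Suc.prems k(1) by (intro convex_on_add convex_on_cmul) auto
    then obtain y where y: "\<forall>i. 0 \<le> y i" "\<forall>x. c \<le> f x + k * h m x + (\<Sum>i<m. y i * h i x)"
      using Suc.IH[of "\<lambda>x. f x + k * h m x"] Suc.prems(2,3) k(2) unfolding X_def by auto
    have "(\<Sum>i<Suc m. (y(m := k)) i * h i x) = k * h m x + (\<Sum>i<m. y i * h i x)" for x
      by simp
    then have "c \<le> f x + (\<Sum>i<Suc m. (y(m := k)) i * h i x)" for x
      using y(2) by (metis add.assoc)
    moreover have "\<forall>i. 0 \<le> (y(m := k)) i"
      using y(1) k(1) by simp
    ultimately show ?case by blast
  qed
  then show thesis using that by blast
qed

section \<open>Convex SPQ polynomials\<close>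

lemma spqE:
  fixes f :: "'n::finite mpoly"
  assumes "spq f"
  obtains s q where "f = q + (\<Sum>i\<in>UNIV. in_var i (s i))" "quadratic q"
  using assms by (auto simp: spq_def separable_def add.commute)

text \<open>Near-minimizers of the \<open>F i\<close> can be chosen independently and assembled into
  a single point, so the inequality passes to the infima up to an arbitrarily small error.\<close>

lemma separable_nonneg_Inf:
  fixes F :: "'n::finite \<Rightarrow> real \<Rightarrow> real"
  assumes w: "\<And>i. 0 \<le> w i"
    and nonneg: "\<And>x :: real ^ 'n. 0 \<le> c + (\<Sum>i\<in>UNIV. w i * F i (x $ i))"
  shows "0 \<le> c + (\<Sum>i\<in>UNIV. w i * (INF t. F i t))"
proof (rule field_le_epsilon)
  fix e :: real assume "0 < e"
  define W where "W = (\<Sum>i\<in>UNIV. w i)"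
  have "0 \<le> W" unfolding W_def by (intro sum_nonneg w)
  \<comment> \<open>The total error is \<open>W * \<delta>\<close>; adding 1 covers the case that
    all weights are zero.\<close>
  define \<delta> where "\<delta> = e / (W + 1)"
  have "0 < \<delta>" using \<open>0 < e\<close> \<open>0 \<le> W\<close> by (simp add: \<delta>_def)
  have "\<exists>t. F i t < (INF t. F i t) + \<delta>" for i
  proof (rule ccontr)
    assume "\<nexists>t. F i t < (INF t. F i t) + \<delta>"
    then have "(INF t. F i t) + \<delta> \<le> (INF t. F i t)"
      by (intro cINF_greatest) (auto simp: not_less)
    with \<open>0 < \<delta>\<close> show False by simp
  qed
  then obtain t where t: "\<And>i. F i (t i) < (INF t. F i t) + \<delta>"
    by metis
  have "0 \<le> c + (\<Sum>i\<in>UNIV. w i * F i (t i))"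
    using nonneg[of "\<chi> i. t i"] by simp
  also have "\<dots> \<le> c + (\<Sum>i\<in>UNIV. w i * ((INF t. F i t) + \<delta>))"
    by (intro add_left_mono sum_mono mult_left_mono w less_imp_le[OF t])
  also have "\<dots> = c + (\<Sum>i\<in>UNIV. w i * (INF t. F i t)) + W * \<delta>"
    by (simp add: W_def distrib_left sum.distrib sum_distrib_right)
  also have "W * \<delta> \<le> e"
    using \<open>0 \<le> W\<close> \<open>0 < e\<close> by (simp add: \<delta>_def divide_simps)
  finally show "0 \<le> c + (\<Sum>i\<in>UNIV. w i * (INF t. F i t)) + e" by simp
qed

section \<open>Second derivatives and decompositions\<close>

lemma quad_form_0 [simp]: "quad_form 0 h = 0"
  by (simp add: quad_form_def)

lemma quad_form_add: "quad_form (f + g) h = quad_form f h + quad_form g h"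
  by (simp add: quad_form_def add_divide_distrib)

lemma quad_form_sum: "quad_form (sum f A) h = (\<Sum>i\<in>A. quad_form (f i) h)"
  by (induction A rule: infinite_finite_induct) (simp_all add: quad_form_add)

lemma quad_form_in_var: "quad_form (in_var i [:0, 0, c:]) h = c * (h $ i)\<^sup>2"
  by (simp add: quad_form_def power2_eq_square)

lemma meval_spq_line:
  fixes q :: "'n::finite mpoly"
  assumes "quadratic q"
  obtains b where "\<And>t. meval (q + (\<Sum>i\<in>UNIV. in_var i (s i))) (x + t *\<^sub>R h) =
    poly ([:meval q x, b, quad_form q h:] + (\<Sum>i\<in>UNIV. pcompose (s i) [:x $ i, h $ i:])) t"
proof -
  obtain b where "\<And>t. meval q (x + t *\<^sub>R h) = meval q x + b * t + quad_form q h * t\<^sup>2"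
    using quadratic_line[OF assms] by blast
  then show thesis
    by (intro that[of b]) (simp add: poly_sum poly_pcompose power2_eq_square algebra_simps)
qed

text \<open>Half the Hessian form at \<open>x\<close> in direction \<open>h\<close>, obtained as
  coefficient 2 of the restriction to the line.\<close>

lemma convex_spq_second_derivative:
  fixes q :: "'n::finite mpoly"
  assumes "quadratic q" and convex: "convex_on UNIV (meval (q + (\<Sum>i\<in>UNIV. in_var i (s i))))"
  shows "0 \<le> quad_form q h + (\<Sum>i\<in>UNIV. (h $ i)\<^sup>2 / 2 * poly (pderiv (pderiv (s i))) (x $ i))"
proof -
  obtain b where b: "\<And>t. meval (q + (\<Sum>i\<in>UNIV. in_var i (s i))) (x + t *\<^sub>R h) =
      poly ([:meval q x, b, quad_form q h:] + (\<Sum>i\<in>UNIV. pcompose (s i) [:x $ i, h $ i:])) t"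
    using meval_spq_line[OF assms(1)] by blast
  have "0 \<le> coeff ([:meval q x, b, quad_form q h:] + (\<Sum>i\<in>UNIV. pcompose (s i) [:x $ i, h $ i:])) 2"
    by (rule convex_poly_coeff_2, rule convex_on_line[OF convex, of x h], rule b)
  then show ?thesis
    by (simp add: coeff_sum coeff_pcompose_line) (simp add: numeral_2_eq_2)
qed

text \<open>The coordinates of \<open>x\<close> vary independently, so in the Hessian \<open>diag (s\<^sub>i'' (x\<^sub>i)) + H\<close> each \<open>s\<^sub>i''\<close>
  can be replaced by its infimum, and the corresponding squares are moved to the quadratic part.\<close>

lemma convex_spq_split:
  fixes f :: "'n::finite mpoly"
  assumes "spq f" "convex_on UNIV (meval f)"
  obtains s q where "f = q + (\<Sum>i\<in>UNIV. in_var i (s i))" "quadratic q"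
    "\<And>i t. 0 \<le> poly (pderiv (pderiv (s i))) t" "\<And>h. 0 \<le> quad_form q h"
proof -
  obtain s q where f: "f = q + (\<Sum>i\<in>UNIV. in_var i (s i))" and q: "quadratic q"
    using assms(1) by (rule spqE)
  note hess = convex_spq_second_derivative[OF q assms(2)[unfolded f]]
  define m where "m i = (INF t. poly (pderiv (pderiv (s i))) t)" for i
  have m: "m i \<le> poly (pderiv (pderiv (s i))) t" for i t
    unfolding m_def
  proof (rule cINF_lower)
    \<comment> \<open>A coordinate direction isolates one univariate part and shows that its second
      derivative is bounded below, so that \<open>m i\<close> is a genuine infimum.\<close>
    have "- 2 * quad_form q (axis i 1) \<le> poly (pderiv (pderiv (s i))) t" for t
    proof -
      have "(\<Sum>j\<in>UNIV. (axis i 1 $ j)\<^sup>2 / 2 * poly (pderiv (pderiv (s j))) t) =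
          (\<Sum>j\<in>UNIV. if j = i then poly (pderiv (pderiv (s i))) t / 2 else 0)"
        by (intro sum.cong) (auto simp: axis_def)
      then show ?thesis
        using hess[of "axis i 1" "\<chi> i. t"] by simp
    qed
    then show "bdd_below (range (poly (pderiv (pderiv (s i)))))"
      by (intro bdd_belowI2)
  qed simp
  define s' where "s' i = s i - [:0, 0, m i / 2:]" for i
  define q' where "q' = q + (\<Sum>i\<in>UNIV. in_var i [:0, 0, m i / 2:])"
  have "f = q' + (\<Sum>i\<in>UNIV. in_var i (s' i))"
    by (simp add: f q'_def s'_def in_var_diff sum_subtractf)
  moreover have "quadratic q'"
    unfolding quadratic_def q'_def using q
    by (intro total_degree_add_le total_degree_sum_le total_degree_in_var_le) (auto simp: quadratic_def)
  moreover have "0 \<le> poly (pderiv (pderiv (s' i))) t" for i t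
    using m[of i t] by (simp add: s'_def pderiv_diff pderiv_pCons)
  moreover have "0 \<le> quad_form q' h" for h
    using separable_nonneg_Inf[of "\<lambda>i. (h $ i)\<^sup>2 / 2" "quad_form q h" "\<lambda>i. poly (pderiv (pderiv (s i)))"] hess
    by (simp add: q'_def quad_form_add quad_form_sum quad_form_in_var m_def[symmetric] mult.commute)
  ultimately show thesis by (rule that)
qed

text \<open>Along a line through \<open>a\<close> the first-order term of \<open>f\<close> vanishes
  by minimality and that of each \<open>u i\<close> because it has a minimum 0 there; hence so does
  that of \<open>q\<close>. Thus \<open>q\<close> is its value at \<open>a\<close>, which equals
  \<open>meval f a \<ge> 0\<close>, plus a positive semidefinite form in
  \<open>x - a\<close>.\<close>

lemma nonneg_convex_spq_decomposition:
  fixes f :: "'n::finite mpoly"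
  assumes "spq f" "convex_on UNIV (meval f)" "nonneg f"
  obtains u q where "f = q + (\<Sum>i\<in>UNIV. in_var i (u i))" "quadratic q" "nonneg q"
    "\<And>i t. 0 \<le> poly (u i) t" "\<And>i t. 0 \<le> poly (pderiv (pderiv (u i))) t"
proof -
  obtain s r where f: "f = r + (\<Sum>i\<in>UNIV. in_var i (s i))" and r: "quadratic r"
    and s: "\<And>i t. 0 \<le> poly (pderiv (pderiv (s i))) t" and form: "\<And>h. 0 \<le> quad_form r h"
    using convex_spq_split[OF assms(1,2)] by blast
  obtain a where a: "\<And>y. meval f a \<le> meval f y"
    using convex_polynomial_attains_min[OF assms(2) continuous_on_meval, of 0] meval_line assms(3)
    unfolding nonneg_def by metis
  define l where "l i = [:poly (s i) (a $ i) - poly (pderiv (s i)) (a $ i) * a $ i, poly (pderiv (s i)) (a $ i):]" for i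
  define u where "u i = s i - l i" for i
  define q where "q = r + (\<Sum>i\<in>UNIV. in_var i (l i))"
  have f': "f = q + (\<Sum>i\<in>UNIV. in_var i (u i))"
    by (simp add: f q_def u_def in_var_diff sum_subtractf)
  have q: "quadratic q"
    unfolding quadratic_def q_def using r
    by (intro total_degree_add_le total_degree_sum_le total_degree_in_var_le) (auto simp: quadratic_def l_def)
  have u_nonneg: "0 \<le> poly (u i) t" for i t
    using poly_above_tangent[OF s, of i "a $ i" t] by (simp add: u_def l_def algebra_simps)
  have u_a: "poly (u i) (a $ i) = 0" for i
    by (simp add: u_def l_def)
  have u_convex: "0 \<le> poly (pderiv (pderiv (u i))) t" for i t
    using s[of i t] by (simp add: u_def l_def pderiv_diff pderiv_pCons)
  have form': "quad_form q h = quad_form r h" for h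
  proof -
    have "quad_form (in_var i (l i)) h = 0" for i
      by (simp add: quad_form_def l_def)
    then show ?thesis by (simp add: q_def quad_form_add quad_form_sum)
  qed
  have "0 \<le> meval q x" for x
  proof -
    define h where "h = x - a"
    obtain b where b: "\<And>t. meval f (a + t *\<^sub>R h) =
        poly ([:meval q a, b, quad_form q h:] + (\<Sum>i\<in>UNIV. pcompose (u i) [:a $ i, h $ i:])) t"
      using meval_spq_line[OF q] unfolding f' by blast
    have fa: "meval f a = meval q a"
      by (simp add: f' u_a)
    define P where "P = [:0, b, quad_form q h:] + (\<Sum>i\<in>UNIV. pcompose (u i) [:a $ i, h $ i:])"
    have P: "poly P t = meval f (a + t *\<^sub>R h) - meval f a" for t
      by (simp add: b fa P_def poly_sum)
    have "coeff P 1 = 0"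
      by (rule nonneg_poly_root_0) (use P a in auto)
    moreover have "coeff (pcompose (u i) [:a $ i, h $ i:]) 1 = 0" for i
      by (rule nonneg_poly_root_0) (auto simp: poly_pcompose u_nonneg u_a)
    ultimately have "b = 0"
      by (simp add: P_def coeff_sum)
    obtain b' where b': "\<And>t. meval q (a + t *\<^sub>R h) = meval q a + b' * t + quad_form q h * t\<^sup>2"
      using quadratic_line[OF q] by blast
    \<comment> \<open>Both linear coefficients were obtained existentially; comparing the two
      expansions at \<open>t = 1\<close> identifies them.\<close>
    have "b' = b"
      using b[of 1] b'[of 1] by (simp add: f' poly_sum poly_pcompose)
    then have "meval q x = meval q a + quad_form q h"
      using b'[of 1] \<open>b = 0\<close> by (simp add: h_def)
    moreover have "0 \<le> meval q a"
      using assms(3) by (simp add: nonneg_def fa[symmetric])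
    ultimately show ?thesis
      using form by (simp add: form')
  qed
  then have "nonneg q" by (simp add: nonneg_def)
  with f' q u_nonneg u_convex show thesis using that by blast
qed

section \<open>The semidefinite programs\<close>

lemma affine_form_const [intro]: "affine_form V (\<lambda>v. c)"
  unfolding affine_form_def by (intro exI[of _ c] exI[of _ "\<lambda>_. 0"]) simp

lemma linear_form_var:
  assumes "finite V" "j \<in> V"
  shows "linear_form V (\<lambda>v. v j)"
proof -
  have "(\<Sum>k\<in>V. of_bool (k = j) * v k) = (\<Sum>k\<in>V. if k = j then v k else 0)" for v :: "_ \<Rightarrow> real"
    by (intro sum.cong) auto
  then have "v j = (\<Sum>k\<in>V. of_bool (k = j) * v k)" for v :: "_ \<Rightarrow> real"
    using assms by simp
  then show ?thesis
    unfolding linear_form_def by (intro exI[of _ "\<lambda>k. of_bool (k = j)"]) blast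
qed

lemma linear_imp_affine_form: "linear_form V e \<Longrightarrow> affine_form V e"
  unfolding linear_form_def affine_form_def by (metis add_0)

lemma affine_form_var [intro]: "finite V \<Longrightarrow> j \<in> V \<Longrightarrow> affine_form V (\<lambda>v. v j)"
  by (intro linear_imp_affine_form linear_form_var)

lemma affine_form_add [intro]:
  assumes "affine_form V e" "affine_form V f"
  shows "affine_form V (\<lambda>v. e v + f v)"
proof -
  obtain c a where "\<And>v. e v = c + (\<Sum>j\<in>V. a j * v j)"
    using assms(1) by (auto simp: affine_form_def)
  moreover obtain c' a' where "\<And>v. f v = c' + (\<Sum>j\<in>V. a' j * v j)"
    using assms(2) by (auto simp: affine_form_def)
  ultimately have "e v + f v = (c + c') + (\<Sum>j\<in>V. (a j + a' j) * v j)" for v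
    by (simp add: distrib_right sum.distrib)
  then show ?thesis
    unfolding affine_form_def by (intro exI[of _ "c + c'"] exI[of _ "\<lambda>j. a j + a' j"]) simp
qed

lemma affine_form_cmult:
  assumes "affine_form V e"
  shows "affine_form V (\<lambda>v. k * e v)"
proof -
  obtain c a where "\<And>v. e v = c + (\<Sum>j\<in>V. a j * v j)"
    using assms by (auto simp: affine_form_def)
  then have "k * e v = k * c + (\<Sum>j\<in>V. (k * a j) * v j)" for v
    by (simp add: distrib_left sum_distrib_left mult.assoc)
  then show ?thesis
    unfolding affine_form_def by (intro exI[of _ "k * c"] exI[of _ "\<lambda>j. k * a j"]) simp
qed

lemma affine_form_multc: "affine_form V e \<Longrightarrow> affine_form V (\<lambda>v. e v * k)"
  using affine_form_cmult[of V e k] by (simp add: mult.commute)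

lemma affine_form_diff:
  "affine_form V e \<Longrightarrow> affine_form V f \<Longrightarrow> affine_form V (\<lambda>v. e v - f v)"
  using affine_form_add[of V e "\<lambda>v. (-1) * f v"] affine_form_cmult[of V f "-1"] by simp

lemma affine_form_sum:
  "(\<And>i. i \<in> A \<Longrightarrow> affine_form V (e i)) \<Longrightarrow> affine_form V (\<lambda>v. \<Sum>i\<in>A. e i v)"
  by (induction A rule: infinite_finite_induct) auto

lemma affine_form_if:
  "(P \<Longrightarrow> affine_form V e) \<Longrightarrow> affine_form V (\<lambda>v. if P then e v else 0)"
  by (cases P) auto

lemmas affine_form_intros = affine_form_const affine_form_var affine_form_add affine_form_cmult
  affine_form_multc affine_form_diff affine_form_sum affine_form_if

section \<open>The data of the programs are finite and affine\<close>

lemma finite_basis: "finite (basis d b)"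
  by (cases b) (simp_all add: mono_deg_le_1_eq del: One_nat_def)

lemma finite_gram_vars: "finite (gram_vars d b)"
  by (simp add: gram_vars_def finite_basis)

lemma finite_decision_vars_spq_sdp: "finite (decision_vars (spq_sdp d p m g))"
  by (simp add: spq_sdp_def finite_gram_vars)

lemma finite_mono_deg_le: "finite {\<mu> :: 'n::finite mono. mono_deg \<mu> \<le> k}"
proof (induction k)
  case (Suc k)
  have "{\<mu> :: 'n mono. mono_deg \<mu> \<le> Suc k} \<subseteq>
      insert 0 ((\<lambda>(i, \<nu>). var_pow i 1 + \<nu>) ` (UNIV \<times> {\<nu>. mono_deg \<nu> \<le> k}))"
  proof
    fix \<mu> :: "'n mono" assume \<mu>: "\<mu> \<in> {\<mu>. mono_deg \<mu> \<le> Suc k}"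
    show "\<mu> \<in> insert 0 ((\<lambda>(i, \<nu>). var_pow i 1 + \<nu>) ` (UNIV \<times> {\<nu>. mono_deg \<nu> \<le> k}))"
    proof (cases "\<mu> = 0")
      case False
      then obtain i \<nu> where "\<mu> = var_pow i 1 + \<nu>" by (rule mono_split_var)
      with \<mu> show ?thesis by auto
    qed simp
  qed
  then show ?case
    by (rule finite_subset) (simp add: Suc)
qed simp

lemma affine_form_gram:
  assumes "finite V" "gram_vars d b \<subseteq> V" "\<alpha> \<in> basis d b" "\<beta> \<in> basis d b"
  shows "affine_form V (\<lambda>v. gram b v \<alpha> \<beta>)"
proof -
  have "Gram b {\<alpha>, \<beta>} \<in> V"
    using assms by (auto simp: gram_vars_def)
  then show ?thesis
    unfolding gram_def using assms(1) by (intro affine_form_var)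
qed

lemma lookup_lagrangian:
  "Poly_Mapping.lookup (lagrangian p m g \<gamma> y) \<mu> =
    Poly_Mapping.lookup p \<mu> - (if \<mu> = 0 then \<gamma> else 0) + (\<Sum>i<m. y i * Poly_Mapping.lookup (g i) \<mu>)"
  by (simp add: lagrangian_def lookup_add lookup_minus lookup_sum lookup_mconst)

text \<open>Here the decision vector enters only through single Gram entries under conditions that
  do not involve it, which is the shape the affine rules handle.\<close>

lemma lookup_quad_part:
  "Poly_Mapping.lookup (quad_part v) \<mu> = (\<Sum>\<alpha> | mono_deg \<alpha> \<le> 1. \<Sum>\<beta> | mono_deg \<beta> \<le> 1.
    if \<alpha> + \<beta> = \<mu> then gram Quad v \<alpha> \<beta> else 0)"
  by (simp add: quad_part_def lookup_sum lookup_single when_def)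

lemma coeff_univ_part:
  "coeff (univ_part d v i) j = (\<Sum>k\<le>d. \<Sum>l\<le>d.
    if k + l = j then gram (Univ i) v (var_pow i k) (var_pow i l) else 0)"
  by (simp add: univ_part_def coeff_sum)

lemma coeff_curv_part:
  "coeff (curv_part d v i) j = (\<Sum>k<d. \<Sum>l<d.
    if k + l = j then gram (Curv i) v (var_pow i k) (var_pow i l) else 0)"
  by (simp add: curv_part_def coeff_sum)

lemma affine_form_coeff_univ_part:
  assumes "finite V" "gram_vars d (Univ i) \<subseteq> V"
  shows "affine_form V (\<lambda>v. coeff (univ_part d v i) j)"
  unfolding coeff_univ_part using assms by (intro affine_form_intros affine_form_gram) auto

lemma affine_form_coeff_curv_part:
  assumes "finite V" "gram_vars d (Curv i) \<subseteq> V"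
  shows "affine_form V (\<lambda>v. coeff (curv_part d v i) j)"
  unfolding coeff_curv_part using assms by (intro affine_form_intros affine_form_gram) auto

lemma affine_form_spq_equation:
  assumes "finite V" "decision_vars (spq_sdp d p m g) \<subseteq> V"
  shows "affine_form V (\<lambda>v. Poly_Mapping.lookup (lagrangian p m g (v Gamma) (\<lambda>i. v (Mult i))
    - (quad_part v + (\<Sum>i\<in>UNIV. in_var i (univ_part d v i)))) \<mu>)"
proof -
  have V: "Gamma \<in> V" "\<And>i. i < m \<Longrightarrow> Mult i \<in> V" "gram_vars d Quad \<subseteq> V"
      "\<And>i. gram_vars d (Univ i) \<subseteq> V"
    using assms(2) by (auto simp: spq_sdp_def UN_subset_iff)
  show ?thesis
    unfolding lookup_minus lookup_add lookup_sum lookup_lagrangian lookup_quad_part lookup_in_var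
    by (intro affine_form_intros affine_form_coeff_univ_part affine_form_gram[where d = d])
      (use assms(1) V in auto)
qed

text \<open>Coefficients are padded with zeros. This transfers the affinity of the data of
  \<open>spq_sdp\<close> to the larger variable set of \<open>spq_sdp_convex\<close>.\<close>

lemma affine_form_mono: "affine_form V e \<Longrightarrow> V \<subseteq> W \<Longrightarrow> finite W \<Longrightarrow> affine_form W e"
  unfolding affine_form_def
proof (elim exE)
  fix c a assume *: "\<forall>v. e v = c + (\<Sum>j\<in>V. a j * v j)" "V \<subseteq> W" "finite W"
  have "(\<Sum>j\<in>V. a j * v j) = (\<Sum>j\<in>W. (if j \<in> V then a j else 0) * v j)" for v
    using *(2,3) by (intro sum.mono_neutral_cong_left) auto
  with *(1) show "\<exists>c a. \<forall>v. e v = c + (\<Sum>j\<in>W. a j * v j)"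
    by (intro exI[of _ c] exI[of _ "\<lambda>j. if j \<in> V then a j else 0"]) simp
qed

lemma gram_commute: "gram b v \<alpha> \<beta> = gram b v \<beta> \<alpha>"
  by (simp add: gram_def insert_commute)

lemma semidefinite_program_spq_sdp: "semidefinite_program (spq_sdp d p m g)"
proof -
  let ?V = "decision_vars (spq_sdp d p m g)"
  have fin: "finite ?V" by (rule finite_decision_vars_spq_sdp)
  have V: "?V = {Gamma} \<union> Mult ` {..<m} \<union> gram_vars d Quad \<union> (\<Union>i. gram_vars d (Univ i))"
    by (simp add: spq_sdp_def)
  have "\<forall>e\<in>equations (spq_sdp d p m g). affine_form ?V e"
    using affine_form_spq_equation[OF fin order.refl] by (auto simp: spq_sdp_def)
  moreover have "linear_form ?V (objective (spq_sdp d p m g))"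
    using linear_form_var[OF fin, of Gamma] by (simp add: spq_sdp_def)
  moreover have "affine_form ?V (\<lambda>v. v (Mult i))" if "i < m" for i
    using that fin by (intro affine_form_var) (auto simp: V)
  moreover have "affine_form ?V (\<lambda>v. gram b v \<alpha> \<beta>)"
    if "b = Quad \<or> (\<exists>i. b = Univ i)" "\<alpha> \<in> basis d b" "\<beta> \<in> basis d b" for b \<alpha> \<beta>
    using that fin by (intro affine_form_gram) (auto simp: V)
  ultimately show ?thesis
    using fin finite_mono_deg_le[of "2 * d"] finite_basis[of d]
    unfolding semidefinite_program_def
    by (auto simp: spq_sdp_def gram_commute simp del: basis.simps)
qed

lemma semidefinite_program_spq_sdp_convex: "semidefinite_program (spq_sdp_convex d p m g)"
proof -
  let ?P = "spq_sdp d p m g" and ?Q = "spq_sdp_convex d p m g"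
  have V: "decision_vars ?Q = decision_vars ?P \<union> (\<Union>i. gram_vars d (Curv i))"
    and E: "equations ?Q = equations ?P
      \<union> (\<lambda>(i, k) v. coeff (pderiv (pderiv (univ_part d v i)) - curv_part d v i) k) ` (UNIV \<times> {..2 * d})"
    and L: "lmis ?Q = lmis ?P \<union> range (\<lambda>i. (basis d (Curv i), gram (Curv i)))"
    and O: "objective ?Q = (\<lambda>v. v Gamma)"
    by (simp_all add: spq_sdp_convex_def Let_def) (simp add: spq_sdp_def)
  have P: "semidefinite_program ?P" by (rule semidefinite_program_spq_sdp)
  have fin: "finite (decision_vars ?Q)"
    by (simp add: V finite_decision_vars_spq_sdp finite_gram_vars)
  have sub: "decision_vars ?P \<subseteq> decision_vars ?Q"
    "Gamma \<in> decision_vars ?Q" "\<And>i. gram_vars d (Univ i) \<subseteq> decision_vars ?Q"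
    "\<And>i. gram_vars d (Curv i) \<subseteq> decision_vars ?Q"
    by (auto simp: V) (auto simp: spq_sdp_def)
  have "affine_form (decision_vars ?Q)
      (\<lambda>v. coeff (pderiv (pderiv (univ_part d v i)) - curv_part d v i) k)" for i k
    unfolding coeff_diff coeff_pderiv
    by (intro affine_form_intros affine_form_coeff_univ_part affine_form_coeff_curv_part fin sub)
  moreover have "affine_form (decision_vars ?Q) (\<lambda>v. gram (Curv i) v \<alpha> \<beta>)"
    if "\<alpha> \<in> basis d (Curv i)" "\<beta> \<in> basis d (Curv i)" for i \<alpha> \<beta>
    using that by (intro affine_form_gram[where d = d] fin sub)
  moreover have "\<forall>e\<in>equations ?P. affine_form (decision_vars ?Q) e"
    using P affine_form_mono[OF _ sub(1) fin] by (auto simp: semidefinite_program_def)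
  moreover have "\<forall>(B, M)\<in>lmis ?P. finite B \<and> (\<forall>r\<in>B. \<forall>s\<in>B.
      affine_form (decision_vars ?Q) (\<lambda>v. M v r s) \<and> (\<forall>v. M v r s = M v s r))"
    using P affine_form_mono[OF _ sub(1) fin] by (fastforce simp: semidefinite_program_def)
  moreover have "linear_form (decision_vars ?Q) (objective ?Q)"
    unfolding O by (intro linear_form_var fin sub)
  moreover have "finite (equations ?Q)" "finite (lmis ?Q)"
    using P by (auto simp: E L semidefinite_program_def)
  ultimately show ?thesis
    using fin finite_basis[of d]
    unfolding semidefinite_program_def E L
    by (auto simp: gram_commute simp del: basis.simps)
qed

section \<open>Positive semidefinite blocks and the polynomials they represent\<close>

lemma psd_on_image:
  assumes "inj_on f B"
  shows "psd_on (f ` B) M \<longleftrightarrow> psd_on B (\<lambda>r s. M (f r) (f s))"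
proof -
  have "(\<Sum>r\<in>f ` B. \<Sum>s\<in>f ` B. z r * M r s * z s) =
      (\<Sum>r\<in>B. \<Sum>s\<in>B. z (f r) * M (f r) (f s) * z (f s))" for z :: "_ \<Rightarrow> real"
    by (simp add: sum.reindex[OF assms])
  \<comment> \<open>On \<open>B\<close> every test vector is a pullback along \<open>f\<close>,
    through the inverse of \<open>f\<close>, and only its values on \<open>B\<close> count.\<close>
  moreover have "(\<forall>z :: _ \<Rightarrow> real. P (\<lambda>r. z (f r))) \<longleftrightarrow> (\<forall>z. P (\<lambda>r. z r))"
    if "\<And>z z'. (\<And>r. r \<in> B \<Longrightarrow> z r = z' r) \<Longrightarrow> P z = P z'" for P
  proof (intro iffI allI)
    fix z :: "_ \<Rightarrow> real" assume "\<forall>z :: _ \<Rightarrow> real. P (\<lambda>r. z (f r))"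
    then have "P (\<lambda>r. (z \<circ> the_inv_into B f) (f r))" by blast
    moreover have "P (\<lambda>r. (z \<circ> the_inv_into B f) (f r)) = P (\<lambda>r. z r)"
      by (rule that) (simp add: the_inv_into_f_f[OF assms])
    ultimately show "P (\<lambda>r. z r)" by simp
  qed blast
  from this[of "\<lambda>z. 0 \<le> (\<Sum>r\<in>B. \<Sum>s\<in>B. z r * M (f r) (f s) * z s)"]
  have "(\<forall>z. 0 \<le> (\<Sum>r\<in>B. \<Sum>s\<in>B. z (f r) * M (f r) (f s) * z (f s))) \<longleftrightarrow>
      (\<forall>z. 0 \<le> (\<Sum>r\<in>B. \<Sum>s\<in>B. z r * M (f r) (f s) * z s))"
    by (auto cong: sum.cong)
  ultimately show ?thesis
    by (simp add: psd_on_def)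
qed

lemma psd_on_singleton: "psd_on {r} (\<lambda>_ _. c) \<longleftrightarrow> 0 \<le> c"
proof
  assume "psd_on {r} (\<lambda>_ _. c)"
  then show "0 \<le> c"
    by (auto simp: psd_on_def dest: spec[of _ "\<lambda>_. 1"])
next
  assume "0 \<le> c"
  then have "0 \<le> z * c * z" for z
    by (metis mult.assoc mult.left_commute mult_nonneg_nonneg zero_le_square)
  then show "psd_on {r} (\<lambda>_ _. c)"
    by (simp add: psd_on_def)
qed

lemma lookup_var_pow [simp]: "Poly_Mapping.lookup (var_pow i k) i = k"
  by (simp add: var_pow_def)

lemma inj_var_pow: "inj_on (var_pow i) A"
proof (rule inj_onI)
  fix k l assume "var_pow i k = var_pow i l"
  from arg_cong[OF this, of "\<lambda>\<mu>. Poly_Mapping.lookup \<mu> i"] show "k = l"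
    by (simp add: var_pow_def)
qed

text \<open>The test vector consists of the powers \<open>t ^ k\<close>.\<close>

lemma poly_univ_part_nonneg:
  assumes "psd_on (basis d (Univ i)) (gram (Univ i) v)"
  shows "0 \<le> poly (univ_part d v i) t"
proof -
  have "0 \<le> (\<Sum>k\<le>d. \<Sum>l\<le>d. t ^ k * gram (Univ i) v (var_pow i k) (var_pow i l) * t ^ l)"
    using assms by (simp add: psd_on_image[OF inj_var_pow]) (simp add: psd_on_def)
  also have "\<dots> = poly (univ_part d v i) t"
    by (simp add: univ_part_def poly_sum poly_monom power_add mult_ac)
  finally show ?thesis .
qed

lemma poly_curv_part_nonneg:
  assumes "psd_on (basis d (Curv i)) (gram (Curv i) v)"
  shows "0 \<le> poly (curv_part d v i) t"
proof -
  have "0 \<le> (\<Sum>k<d. \<Sum>l<d. t ^ k * gram (Curv i) v (var_pow i k) (var_pow i l) * t ^ l)"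
    using assms by (simp add: psd_on_image[OF inj_var_pow]) (simp add: psd_on_def)
  also have "\<dots> = poly (curv_part d v i) t"
    by (simp add: curv_part_def poly_sum poly_monom power_add mult_ac)
  finally show ?thesis .
qed

lemma nonneg_quad_part:
  assumes "psd_on (basis d Quad) (gram Quad v)"
  shows "nonneg (quad_part v)"
proof -
  have "0 \<le> meval (quad_part v) x" for x
  proof -
    have "0 \<le> (\<Sum>\<alpha> | mono_deg \<alpha> \<le> 1. \<Sum>\<beta> | mono_deg \<beta> \<le> 1.
        mono_eval \<alpha> x * gram Quad v \<alpha> \<beta> * mono_eval \<beta> x)"
      using assms by (simp add: psd_on_def)
    also have "\<dots> = meval (quad_part v) x"
      by (simp add: quad_part_def mono_eval_add mult_ac)
    finally show ?thesis .
  qed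
  then show ?thesis by (simp add: nonneg_def)
qed

lemma quadratic_quad_part: "quadratic (quad_part v)"
proof -
  have "total_degree (Poly_Mapping.single (\<alpha> + \<beta>) c) \<le> 2"
    if "mono_deg \<alpha> \<le> 1" "mono_deg \<beta> \<le> 1" for \<alpha> \<beta> c
    using that by (auto simp: total_degree_le_iff lookup_single when_def)
  then show ?thesis
    unfolding quadratic_def quad_part_def by (intro total_degree_sum_le) auto
qed

lemma degree_univ_part: "degree (univ_part d v i) \<le> 2 * d"
  unfolding univ_part_def
  by (intro degree_sum_le ballI order.trans[OF degree_monom_le]) auto

lemma degree_curv_part: "degree (curv_part d v i) \<le> 2 * d"
  unfolding curv_part_def
  by (intro degree_sum_le ballI order.trans[OF degree_monom_le]) auto

text \<open>Since \<open>Gram b {\<alpha>, \<beta>}\<close> carries an unordered pair, a family of symmetric matrices determines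
  the decision vector.\<close>

lemma dvar_of_grams:
  assumes "\<And>b \<alpha> \<beta>. G b \<alpha> \<beta> = G b \<beta> \<alpha>"
  obtains v :: "'n dvar \<Rightarrow> real"
  where "v Gamma = \<gamma>" "\<And>i. v (Mult i) = y i" "\<And>b \<alpha> \<beta>. gram b v \<alpha> \<beta> = G b \<alpha> \<beta>"
proof
  define v where "v x = (case x of Gamma \<Rightarrow> \<gamma> | Mult i \<Rightarrow> y i
    | Gram b S \<Rightarrow> (SOME r. \<exists>\<alpha> \<beta>. S = {\<alpha>, \<beta>} \<and> r = G b \<alpha> \<beta>))" for x
  show "v Gamma = \<gamma>" "v (Mult i) = y i" for i
    by (simp_all add: v_def)
  show "gram b v \<alpha> \<beta> = G b \<alpha> \<beta>" for b \<alpha> \<beta>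
  proof -
    \<comment> \<open>The unordered pair fixes its members up to a swap, and symmetry of
      \<open>G\<close> makes the chosen value independent of it.\<close>
    have "(SOME r. \<exists>\<alpha>' \<beta>'. {\<alpha>, \<beta>} = {\<alpha>', \<beta>'} \<and> r = G b \<alpha>' \<beta>') = G b \<alpha> \<beta>"
      using assms by (intro some_equality) (auto simp: doubleton_eq_iff)
    then show ?thesis by (simp add: gram_def v_def)
  qed
qed

text \<open>Serves both programs: the curvature parts are arbitrary nonnegative polynomials here and
  can be set to zero. The bound \<open>2 * (d - 1)\<close> fits a Gram matrix on the
  \<open>d\<close> powers with exponents below \<open>d\<close>.\<close>

lemma dvar_of_certificate:
  fixes q :: "'n::finite mpoly" and u c :: "'n \<Rightarrow> real poly"
  assumes "d \<ge> 1" and q: "quadratic q" "nonneg q"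
    and u: "\<And>i t. 0 \<le> poly (u i) t" "\<And>i. degree (u i) \<le> 2 * d"
    and c: "\<And>i t. 0 \<le> poly (c i) t" "\<And>i. degree (c i) \<le> 2 * (d - 1)"
  obtains v where "v Gamma = \<gamma>" "\<And>i. v (Mult i) = y i"
    "quad_part v = q" "\<And>i. univ_part d v i = u i" "\<And>i. curv_part d v i = c i"
    "\<And>b. psd_on (basis d b) (gram b v)"
proof -
  have "\<forall>i. \<exists>G. psd_on {..d} G \<and> u i = (\<Sum>k\<le>d. \<Sum>l\<le>d. monom (G k l) (k + l))
      \<and> (\<forall>k l. G k l = G l k)"
    using nonneg_poly_gram[OF u(1,2)] by blast
  from choice[OF this] obtain GU
    where GU: "\<forall>i. psd_on {..d} (GU i) \<and> u i = (\<Sum>k\<le>d. \<Sum>l\<le>d. monom (GU i k l) (k + l))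
      \<and> (\<forall>k l. GU i k l = GU i l k)" ..
  have d: "{..d - 1} = {..<d}" using \<open>d \<ge> 1\<close> by auto
  have "\<forall>i. \<exists>G. psd_on {..<d} G \<and> c i = (\<Sum>k<d. \<Sum>l<d. monom (G k l) (k + l))
      \<and> (\<forall>k l. G k l = G l k)"
    using nonneg_poly_gram[OF c(1,2)] unfolding d by blast
  from choice[OF this] obtain GC
    where GC: "\<forall>i. psd_on {..<d} (GC i) \<and> c i = (\<Sum>k<d. \<Sum>l<d. monom (GC i k l) (k + l))
      \<and> (\<forall>k l. GC i k l = GC i l k)" ..
  define G where "G b \<alpha> \<beta> = (case b of Quad \<Rightarrow> quad_gram q \<alpha> \<beta>
    | Univ i \<Rightarrow> GU i (Poly_Mapping.lookup \<alpha> i) (Poly_Mapping.lookup \<beta> i)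
    | Curv i \<Rightarrow> GC i (Poly_Mapping.lookup \<alpha> i) (Poly_Mapping.lookup \<beta> i))" for b and \<alpha> \<beta> :: "'n mono"
  have "G b \<alpha> \<beta> = G b \<beta> \<alpha>" for b \<alpha> \<beta>
  proof (cases b)
    case Quad
    then show ?thesis by (simp add: G_def quad_gram_commute)
  next
    case (Univ i)
    then show ?thesis using GU by (simp add: G_def)
  next
    case (Curv i)
    then show ?thesis using GC by (simp add: G_def)
  qed
  then obtain v where v: "v Gamma = \<gamma>" "\<And>i. v (Mult i) = y i" "\<And>b \<alpha> \<beta>. gram b v \<alpha> \<beta> = G b \<alpha> \<beta>"
    using dvar_of_grams[of G \<gamma> y] by metis
  have "psd_on (basis d b) (gram b v)" for b
  proof (cases b)
    case Quad
    have "gram Quad v = quad_gram q" by (intro ext) (simp add: v G_def)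
    then show ?thesis using nonneg_quadratic_gram_psd[OF q] by (simp add: Quad)
  next
    case (Univ i)
    then show ?thesis using GU by (simp add: psd_on_image[OF inj_var_pow] v G_def)
  next
    case (Curv i)
    then show ?thesis using GC by (simp add: psd_on_image[OF inj_var_pow] v G_def)
  qed
  moreover have "quad_part v = q"
    using quad_gram_sum[OF q(1)] by (simp add: quad_part_def v G_def)
  moreover have "univ_part d v i = u i" "curv_part d v i = c i" for i
    by (simp_all only: univ_part_def curv_part_def v G_def block.case lookup_var_pow GU[rule_format, of i] GC[rule_format, of i])
  ultimately show thesis
    using that[of v] v by blast
qed

section \<open>Duality and optimal solutions\<close>

lemma in_var_smult: "in_var i (smult c s) = mconst c * in_var i s"
  by (intro poly_mapping_eqI) (simp add: lookup_in_var)

lemma spqI: "quadratic q \<Longrightarrow> spq (q + (\<Sum>i\<in>UNIV. in_var i (s i)))"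
  unfolding spq_def separable_def by (metis add.commute)

lemma spq_quadratic: "quadratic q \<Longrightarrow> spq q"
  using spqI[of q "\<lambda>_. 0"] by simp

lemma spq_add:
  assumes "spq f" "spq g"
  shows "spq (f + g)"
proof -
  obtain s q where f: "f = q + (\<Sum>i\<in>UNIV. in_var i (s i))" "quadratic q"
    using assms(1) by (rule spqE)
  obtain t r where g: "g = r + (\<Sum>i\<in>UNIV. in_var i (t i))" "quadratic r"
    using assms(2) by (rule spqE)
  have "f + g = (q + r) + (\<Sum>i\<in>UNIV. in_var i (s i + t i))"
    by (simp add: f g in_var_add sum.distrib algebra_simps)
  moreover have "quadratic (q + r)"
    using f(2) g(2) unfolding quadratic_def by (rule total_degree_add_le)
  ultimately show ?thesis by (metis spqI)
qed

lemma spq_mconst_times: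
  assumes "spq f"
  shows "spq (mconst c * f)"
proof -
  obtain s q where f: "f = q + (\<Sum>i\<in>UNIV. in_var i (s i))" "quadratic q"
    using assms by (rule spqE)
  have "mconst c * f = mconst c * q + (\<Sum>i\<in>UNIV. in_var i (smult c (s i)))"
    by (simp add: f in_var_smult distrib_left sum_distrib_left)
  moreover have "quadratic (mconst c * q)"
    using f(2) unfolding quadratic_def by (rule total_degree_mconst_times_le)
  ultimately show ?thesis by (metis spqI)
qed

lemma spq_mconst: "spq (mconst c)"
  by (intro spq_quadratic) (simp add: quadratic_def total_degree_mconst_le)

lemma spq_sum: "(\<And>i. i \<in> A \<Longrightarrow> spq (f i)) \<Longrightarrow> spq (sum f A)"
proof (induction A rule: infinite_finite_induct)
  case (insert x A)
  then show ?case by (simp add: spq_add)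
qed (use spq_mconst[of 0] in \<open>simp_all add: mconst_def\<close>)

lemma lagrangian_eq_add:
  "lagrangian p m g \<gamma> y = p + mconst (- \<gamma>) + (\<Sum>i<m. mconst (y i) * g i)"
  by (simp add: lagrangian_def mconst_def single_uminus)

lemma lagrangian_cong:
  "(\<And>i. i < m \<Longrightarrow> y i = y' i) \<Longrightarrow> lagrangian p m g \<gamma> y = lagrangian p m g \<gamma> y'"
  by (simp add: lagrangian_def)

lemma meval_lagrangian:
  "meval (lagrangian p m g \<gamma> y) x = meval p x - \<gamma> + (\<Sum>i<m. y i * meval (g i) x)"
  by (simp add: lagrangian_def)

lemma spq_lagrangian:
  assumes "spq p" "\<And>i. i < m \<Longrightarrow> spq (g i)"
  shows "spq (lagrangian p m g \<gamma> y)"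
  unfolding lagrangian_eq_add using assms
  by (intro spq_add spq_sum spq_mconst_times spq_mconst) auto

lemma total_degree_lagrangian:
  assumes "total_degree p \<le> k" "\<And>i. i < m \<Longrightarrow> total_degree (g i) \<le> k"
  shows "total_degree (lagrangian p m g \<gamma> y) \<le> k"
  unfolding lagrangian_eq_add using assms
  by (intro total_degree_add_le total_degree_sum_le total_degree_mconst_times_le total_degree_mconst_le) auto

lemma convex_on_constraint_sum:
  fixes g :: "nat \<Rightarrow> 'n::finite mpoly"
  assumes "\<And>i. i < m \<Longrightarrow> convex_on UNIV (meval (g i))" "\<And>i. i < m \<Longrightarrow> 0 \<le> y i"
  shows "convex_on UNIV (\<lambda>x. \<Sum>i<m. y i * meval (g i) x)"
  using assms
proof (induction m)
  case (Suc m)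
  then show ?case by (auto intro!: convex_on_add convex_on_cmul)
qed (simp add: convex_on_const)

lemma convex_on_lagrangian:
  fixes p :: "'n::finite mpoly"
  assumes "convex_on UNIV (meval p)" "\<And>i. i < m \<Longrightarrow> convex_on UNIV (meval (g i))"
    and "\<And>i. i < m \<Longrightarrow> 0 \<le> y i"
  shows "convex_on UNIV (meval (lagrangian p m g \<gamma> y))"
proof -
  have "convex_on UNIV (\<lambda>x. meval p x + - \<gamma> + (\<Sum>i<m. y i * meval (g i) x))"
    using assms by (intro convex_on_add convex_on_constraint_sum) (auto simp: convex_on_const)
  then show ?thesis
    by (simp add: meval_lagrangian[abs_def])
qed

lemma strictly_convex_lagrangian:
  fixes p :: "'n::finite mpoly"
  assumes "strictly_convex (meval p)" "\<And>i. i < m \<Longrightarrow> convex_on UNIV (meval (g i))"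
    and "\<And>i. i < m \<Longrightarrow> 0 \<le> y i"
  shows "strictly_convex (meval (lagrangian p m g \<gamma> y))"
  unfolding strictly_convex_def
proof (intro allI impI)
  fix x z :: "real ^ 'n" and t :: real
  assume t: "x \<noteq> z \<and> 0 < t \<and> t < 1"
  define h where "h x = (\<Sum>i<m. y i * meval (g i) x)" for x
  have "h ((1 - t) *\<^sub>R x + t *\<^sub>R z) \<le> (1 - t) * h x + t * h z"
    using convex_onD[OF convex_on_constraint_sum[of m g y, OF assms(2,3)], of t x z] t by (simp add: h_def)
  moreover have "meval p ((1 - t) *\<^sub>R x + t *\<^sub>R z) < (1 - t) * meval p x + t * meval p z"
    using assms(1) t unfolding strictly_convex_def by blast
  moreover have "\<gamma> = (1 - t) * \<gamma> + t * \<gamma>"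
    by (simp add: algebra_simps)
  ultimately show "meval (lagrangian p m g \<gamma> y) ((1 - t) *\<^sub>R x + t *\<^sub>R z) <
      (1 - t) * meval (lagrangian p m g \<gamma> y) x + t * meval (lagrangian p m g \<gamma> y) z"
    unfolding meval_lagrangian h_def[symmetric] distrib_left right_diff_distrib by linarith
qed

text \<open>High pure powers cannot cancel: for \<open>k > 2 * d \<ge> 2\<close> the coefficient of
  the \<open>k\<close>-th power of variable \<open>i\<close> receives no contribution from
  \<open>q\<close> or from the other variables.\<close>

lemma degree_le_of_total_degree:
  assumes "quadratic q" "total_degree (q + (\<Sum>i\<in>UNIV. in_var i (u i))) \<le> 2 * d" "d \<ge> 1"
  shows "degree (u i) \<le> 2 * d"
proof (rule degree_le, intro allI impI)
  fix k assume k: "2 * d < k"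
  have "Poly_Mapping.lookup (in_var j (u j)) (var_pow i k) = (if j = i then coeff (u i) k else 0)" for j
    using k by (simp add: lookup_in_var var_pow_eq_iff)
  moreover have "Poly_Mapping.lookup q (var_pow i k) = 0"
    using assms(1,3) k by (auto simp: quadratic_def total_degree_le_iff dest!: spec[of _ "var_pow i k"])
  moreover have "Poly_Mapping.lookup (q + (\<Sum>i\<in>UNIV. in_var i (u i))) (var_pow i k) = 0"
    using assms(2) k by (auto simp: total_degree_le_iff dest!: spec[of _ "var_pow i k"])
  ultimately show "coeff (u i) k = 0"
    by (simp add: lookup_add lookup_sum)
qed

text \<open>The finitely many equations amount to a polynomial identity, since both sides have
  degree at most \<open>2 * d\<close>.\<close>

lemma spq_sdp_feasible_iff:
  assumes "d \<ge> 1" "total_degree p \<le> 2 * d" "\<And>i. i < m \<Longrightarrow> total_degree (g i) \<le> 2 * d"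
  shows "v \<in> sdp_feasible (spq_sdp d p m g) \<longleftrightarrow>
    lagrangian p m g (v Gamma) (\<lambda>i. v (Mult i)) = quad_part v + (\<Sum>i\<in>UNIV. in_var i (univ_part d v i)) \<and>
    (\<forall>i<m. 0 \<le> v (Mult i)) \<and> psd_on (basis d Quad) (gram Quad v) \<and>
    (\<forall>i. psd_on (basis d (Univ i)) (gram (Univ i) v))"
proof -
  let ?D = "lagrangian p m g (v Gamma) (\<lambda>i. v (Mult i))
    - (quad_part v + (\<Sum>i\<in>UNIV. in_var i (univ_part d v i)))"
  have "total_degree ?D \<le> 2 * d"
    using assms quadratic_quad_part[of v] degree_univ_part[of d v] unfolding quadratic_def
    by (intro total_degree_diff_le total_degree_add_le total_degree_sum_le total_degree_in_var_le
        total_degree_lagrangian) auto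
  then have "Poly_Mapping.lookup ?D \<mu> = 0" if "\<not> mono_deg \<mu> \<le> 2 * d" for \<mu>
    using that unfolding total_degree_le_iff by blast
  then have "?D = 0" if "\<forall>\<mu>. mono_deg \<mu> \<le> 2 * d \<longrightarrow> Poly_Mapping.lookup ?D \<mu> = 0"
    using that by (intro poly_mapping_eqI) (metis lookup_zero)
  then have "(\<forall>\<mu>. mono_deg \<mu> \<le> 2 * d \<longrightarrow> Poly_Mapping.lookup ?D \<mu> = 0) \<longleftrightarrow> ?D = 0"
    by auto
  then show ?thesis
    by (auto simp: sdp_feasible_def spq_sdp_def psd_on_singleton ball_Un simp del: basis.simps)
qed

lemma spq_sdp_convex_feasible_iff:
  "v \<in> sdp_feasible (spq_sdp_convex d p m g) \<longleftrightarrow> v \<in> sdp_feasible (spq_sdp d p m g) \<and>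
    (\<forall>i. pderiv (pderiv (univ_part d v i)) = curv_part d v i \<and>
      psd_on (basis d (Curv i)) (gram (Curv i) v))"
proof -
  have "(\<forall>k\<le>2 * d. coeff (pderiv (pderiv (univ_part d v i)) - curv_part d v i) k = 0) \<longleftrightarrow>
      pderiv (pderiv (univ_part d v i)) = curv_part d v i" for i
  proof -
    let ?D = "pderiv (pderiv (univ_part d v i)) - curv_part d v i"
    have "degree ?D \<le> 2 * d"
      using degree_univ_part[of d v i] degree_curv_part[of d v i]
      by (intro degree_diff_le) (simp_all add: degree_pderiv)
    then have "coeff ?D k = 0" if "\<not> k \<le> 2 * d" for k
      using that by (intro coeff_eq_0) linarith
    then have "?D = 0" if "\<forall>k\<le>2 * d. coeff ?D k = 0"
      using that by (intro poly_eqI) (metis coeff_0)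
    then have "(\<forall>k\<le>2 * d. coeff ?D k = 0) \<longleftrightarrow> ?D = 0"
      by auto
    then show ?thesis by simp
  qed
  then show ?thesis
    by (auto simp: sdp_feasible_def spq_sdp_convex_def Let_def ball_Un simp del: basis.simps coeff_diff)
qed

text \<open>The coordinates vary independently, so the infima of the summands still have a
  nonnegative sum. Shifting by them makes every summand nonnegative.\<close>

lemma separable_nonneg_summands:
  fixes s :: "'n::finite \<Rightarrow> real poly"
  assumes "nonneg (\<Sum>i\<in>UNIV. in_var i (s i))"
  obtains c where "\<And>i t. c i \<le> poly (s i) t" "0 \<le> (\<Sum>i\<in>UNIV. c i)"
proof
  have nonneg: "0 \<le> (\<Sum>i\<in>UNIV. poly (s i) (x $ i))" for x :: "real ^ 'n"
    using assms by (simp add: nonneg_def)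
  define c where "c i = (INF t. poly (s i) t)" for i
  show "0 \<le> (\<Sum>i\<in>UNIV. c i)"
    using separable_nonneg_Inf[of "\<lambda>_. 1" 0 "\<lambda>i. poly (s i)"] nonneg by (simp add: c_def)
  show "c i \<le> poly (s i) t" for i t
    unfolding c_def
  proof (rule cINF_lower)
    \<comment> \<open>With all other coordinates fixed at 0, nonnegativity of the sum bounds the
      summand in variable \<open>i\<close> from below.\<close>
    have "- (\<Sum>j\<in>UNIV - {i}. poly (s j) 0) \<le> poly (s i) t" for t
      using nonneg[of "axis i t"] sum.remove[of UNIV i "\<lambda>j. poly (s j) (axis i t $ j)"]
      by (simp add: axis_def)
    then show "bdd_below (range (poly (s i)))"
      by (intro bdd_belowI2)
  qed simp
qed

text \<open>Bridges nonnegativity of the separable part as a whole and of each summand: the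
  constants \<open>c i\<close> move to the quadratic part, where their nonnegative sum does no
  harm.\<close>

lemma NS_plus_NQ_iff:
  fixes f :: "'n::finite mpoly"
  assumes "spq f" "total_degree f \<le> 2 * d"
  shows "f \<in> NS_plus_NQ d \<longleftrightarrow> (\<exists>u q. f = q + (\<Sum>i\<in>UNIV. in_var i (u i)) \<and>
    quadratic q \<and> nonneg q \<and> (\<forall>i t. 0 \<le> poly (u i) t))"
proof
  assume "f \<in> NS_plus_NQ d"
  then obtain s q where f: "f = q + (\<Sum>i\<in>UNIV. in_var i (s i))"
      and s: "nonneg (\<Sum>i\<in>UNIV. in_var i (s i))" and q: "quadratic q" "nonneg q"
    by (auto simp: NS_plus_NQ_def separable_def add.commute)
  obtain c where c: "\<And>i t. c i \<le> poly (s i) t" "0 \<le> (\<Sum>i\<in>UNIV. c i)"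
    using separable_nonneg_summands[OF s] by blast
  have "(\<Sum>i\<in>UNIV. mconst (c i)) = (mconst (\<Sum>i\<in>UNIV. c i) :: 'n mpoly)"
    by (intro poly_mapping_eqI) (simp add: lookup_sum lookup_mconst)
  then have "f = (q + mconst (\<Sum>i\<in>UNIV. c i)) + (\<Sum>i\<in>UNIV. in_var i (s i - [:c i:]))"
    by (simp add: f in_var_diff in_var_const sum_subtractf)
  moreover have "quadratic (q + mconst (\<Sum>i\<in>UNIV. c i))"
    using q(1) unfolding quadratic_def by (intro total_degree_add_le total_degree_mconst_le)
  moreover have "nonneg (q + mconst (\<Sum>i\<in>UNIV. c i))"
    using q(2) c(2) by (simp add: nonneg_def)
  moreover have "\<forall>i t. 0 \<le> poly (s i - [:c i:]) t"
    using c(1) by simp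
  ultimately show "\<exists>u q. f = q + (\<Sum>i\<in>UNIV. in_var i (u i)) \<and>
      quadratic q \<and> nonneg q \<and> (\<forall>i t. 0 \<le> poly (u i) t)"
    by (intro exI conjI)
next
  assume "\<exists>u q. f = q + (\<Sum>i\<in>UNIV. in_var i (u i)) \<and>
    quadratic q \<and> nonneg q \<and> (\<forall>i t. 0 \<le> poly (u i) t)"
  then obtain u q where f: "f = (\<Sum>i\<in>UNIV. in_var i (u i)) + q"
      and q: "quadratic q" "nonneg q" and u: "\<forall>i t. 0 \<le> poly (u i) t"
    by (auto simp: add.commute)
  have "nonneg (\<Sum>i\<in>UNIV. in_var i (u i))"
    using u by (simp add: nonneg_def sum_nonneg)
  moreover have "separable (\<Sum>i\<in>UNIV. in_var i (u i))"
    by (auto simp: separable_def)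
  ultimately show "f \<in> NS_plus_NQ d"
    using assms q f unfolding NS_plus_NQ_def by blast
qed

section \<open>Strong duality under Slater's condition\<close>

locale convex_spq_problem =
  fixes d m :: nat and p :: "'n::finite mpoly" and g :: "nat \<Rightarrow> 'n mpoly"
  assumes d: "d \<ge> 1"
    and p: "spq p" "total_degree p \<le> 2 * d" "convex_on UNIV (meval p)"
    and g: "\<And>i. i < m \<Longrightarrow> spq (g i)" "\<And>i. i < m \<Longrightarrow> total_degree (g i) \<le> 2 * d"
      "\<And>i. i < m \<Longrightarrow> convex_on UNIV (meval (g i))"
    and Slater: "\<exists>z. \<forall>i<m. meval (g i) z < 0"
begin

abbreviation "K \<equiv> constraint_set m g"
abbreviation "L \<equiv> lagrangian p m g"

lemma spq_L: "spq (L \<gamma> y)"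
  using p(1) g(1) by (rule spq_lagrangian)

lemma total_degree_L: "total_degree (L \<gamma> y) \<le> 2 * d"
  using p(2) g(2) by (rule total_degree_lagrangian)

lemmas feasible_iff = spq_sdp_feasible_iff[OF d p(2), where m = m and g = g, OF g(2)]

lemma feasible_parts_nonneg:
  assumes "v \<in> sdp_feasible (spq_sdp d p m g)"
  shows "0 \<le> poly (univ_part d v i) t" "nonneg (quad_part v)"
  using assms by (auto simp: feasible_iff simp del: basis.simps intro: poly_univ_part_nonneg nonneg_quad_part)

lemma dual_feasible_iff_sdp_feasible:
  "(\<gamma>, y) \<in> dual_feasible d p m g \<longleftrightarrow>
    (\<exists>v\<in>sdp_feasible (spq_sdp d p m g). v Gamma = \<gamma> \<and> (\<forall>i<m. v (Mult i) = y i))"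
proof
  assume dual: "(\<gamma>, y) \<in> dual_feasible d p m g"
  then obtain u q where uq: "L \<gamma> y = q + (\<Sum>i\<in>UNIV. in_var i (u i))"
      "quadratic q" "nonneg q" "\<And>i t. 0 \<le> poly (u i) t"
    unfolding dual_feasible_def NS_plus_NQ_iff[OF spq_L total_degree_L] by blast
  have "degree (u i) \<le> 2 * d" for i
    using degree_le_of_total_degree[OF uq(2) _ d] total_degree_L[of \<gamma> y] unfolding uq(1) .
  then obtain v where v: "v Gamma = \<gamma>" "\<And>i. v (Mult i) = y i" "quad_part v = q"
      "\<And>i. univ_part d v i = u i" "\<And>b. psd_on (basis d b) (gram b v)"
    \<comment> \<open>The curvature blocks do not enter \<open>spq_sdp\<close>, so zero serves as
      their default.\<close>
    using dvar_of_certificate[where u = u and c = "\<lambda>_. 0" and \<gamma> = \<gamma> and y = y, OF d uq(2,3,4)] by auto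
  have "v \<in> sdp_feasible (spq_sdp d p m g)"
    using dual by (simp add: feasible_iff v uq dual_feasible_def del: basis.simps)
  with v show "\<exists>v\<in>sdp_feasible (spq_sdp d p m g). v Gamma = \<gamma> \<and> (\<forall>i<m. v (Mult i) = y i)"
    by blast
next
  assume "\<exists>v\<in>sdp_feasible (spq_sdp d p m g). v Gamma = \<gamma> \<and> (\<forall>i<m. v (Mult i) = y i)"
  then obtain v where v: "v \<in> sdp_feasible (spq_sdp d p m g)" "v Gamma = \<gamma>" "\<And>i. i < m \<Longrightarrow> v (Mult i) = y i"
    by blast
  have "L \<gamma> y = L (v Gamma) (\<lambda>i. v (Mult i))"
    using v(2,3) lagrangian_cong by metis
  also have "\<dots> = quad_part v + (\<Sum>i\<in>UNIV. in_var i (univ_part d v i))"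
    using v(1) by (simp add: feasible_iff del: basis.simps)
  finally have "L \<gamma> y \<in> NS_plus_NQ d"
    unfolding NS_plus_NQ_iff[OF spq_L total_degree_L]
    using feasible_parts_nonneg[OF v(1)] quadratic_quad_part by blast
  moreover have "\<forall>i<m. 0 \<le> y i"
    using v by (auto simp: feasible_iff simp del: basis.simps)
  ultimately show "(\<gamma>, y) \<in> dual_feasible d p m g"
    by (simp add: dual_feasible_def)
qed

lemma lagrangian_nonneg:
  assumes "\<And>x. x \<in> K \<Longrightarrow> c \<le> meval p x"
  obtains y where "\<And>i. 0 \<le> y i" "nonneg (L c y)"
proof -
  obtain z where "\<And>i. i < m \<Longrightarrow> meval (g i) z < 0"
    using Slater by blast
  then obtain y where y: "\<And>i. 0 \<le> y i" "\<And>x. c \<le> meval p x + (\<Sum>i<m. y i * meval (g i) x)"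
    using lagrange_multipliers[OF p(3), where h = "\<lambda>i. meval (g i)" and m = m and z = z and c = c, OF g(3)] assms unfolding constraint_set_def by blast
  have "0 \<le> meval p x - c + (\<Sum>i<m. y i * meval (g i) x)" for x
    using y(2)[of x] by linarith
  then have "nonneg (L c y)"
    by (simp add: nonneg_def meval_lagrangian)
  with y(1) show thesis by (rule that)
qed

lemma convex_certificate:
  assumes "\<And>x. x \<in> K \<Longrightarrow> c \<le> meval p x"
  obtains y u q where "\<And>i. 0 \<le> y i" "L c y = q + (\<Sum>i\<in>UNIV. in_var i (u i))"
    "quadratic q" "nonneg q" "\<And>i t. 0 \<le> poly (u i) t" "\<And>i t. 0 \<le> poly (pderiv (pderiv (u i))) t"
proof -
  obtain y where y: "\<And>i. 0 \<le> y i" "nonneg (L c y)"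
    using lagrangian_nonneg[OF assms] by blast
  have "convex_on UNIV (meval (L c y))"
    using convex_on_lagrangian[OF p(3), where m = m and g = g, OF g(3)] y(1) by blast
  then show thesis
    by (rule nonneg_convex_spq_decomposition[OF spq_L _ y(2)]) (rule that[OF y(1)])
qed

lemma weak_duality:
  assumes "v \<in> sdp_feasible (spq_sdp d p m g)" "x \<in> K"
  shows "v Gamma \<le> meval p x"
proof -
  have "0 \<le> meval (quad_part v + (\<Sum>i\<in>UNIV. in_var i (univ_part d v i))) x"
    using feasible_parts_nonneg[OF assms(1)] by (simp add: nonneg_def sum_nonneg)
  also have "\<dots> = meval p x - v Gamma + (\<Sum>i<m. v (Mult i) * meval (g i) x)"
    using assms(1) by (simp add: feasible_iff meval_lagrangian[symmetric] del: basis.simps)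
  also have "\<dots> \<le> meval p x - v Gamma"
    using assms by (auto simp: feasible_iff constraint_set_def mult_nonneg_nonpos intro!: sum_nonpos simp del: basis.simps)
  finally show ?thesis by simp
qed

text \<open>Every lower bound of \<open>p\<close> on \<open>K\<close> is attained as an objective
  value in both programs. With the optimal value as \<open>c\<close> this gives attainment of the
  dual supremum.\<close>

lemma convex_sdp_feasible:
  assumes "\<And>x. x \<in> K \<Longrightarrow> c \<le> meval p x"
  obtains v where "v \<in> sdp_feasible (spq_sdp_convex d p m g)" "v \<in> sdp_feasible (spq_sdp d p m g)"
    "v Gamma = c"
proof -
  obtain y u q where uq: "\<And>i. 0 \<le> y i" "L c y = q + (\<Sum>i\<in>UNIV. in_var i (u i))"
      "quadratic q" "nonneg q" "\<And>i t. 0 \<le> poly (u i) t" "\<And>i t. 0 \<le> poly (pderiv (pderiv (u i))) t"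
    by (rule convex_certificate[OF assms]) (assumption, rule that)
  have deg: "degree (u i) \<le> 2 * d" for i
    using degree_le_of_total_degree[OF uq(3) _ d] total_degree_L[of c y] unfolding uq(2) .
  have "degree (pderiv (pderiv (u i))) \<le> 2 * (d - 1)" for i
    using deg[of i] by (simp add: degree_pderiv)
  then obtain v where v: "v Gamma = c" "\<And>i. v (Mult i) = y i" "quad_part v = q"
      "\<And>i. univ_part d v i = u i" "\<And>i. curv_part d v i = pderiv (pderiv (u i))"
      "\<And>b. psd_on (basis d b) (gram b v)"
    by (rule dvar_of_certificate[where u = u and c = "\<lambda>i. pderiv (pderiv (u i))" and \<gamma> = c and y = y,
          OF d uq(3,4,5) deg uq(6)]) (rule that)
  have "v \<in> sdp_feasible (spq_sdp d p m g)"
    by (simp add: feasible_iff v uq del: basis.simps)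
  moreover from this have "v \<in> sdp_feasible (spq_sdp_convex d p m g)"
    by (simp add: spq_sdp_convex_feasible_iff v del: basis.simps)
  ultimately show thesis using that v(1) by blast
qed

lemma opt_value_lower_bound: "opt_value p m g = ereal c \<Longrightarrow> x \<in> K \<Longrightarrow> c \<le> meval p x"
  unfolding opt_value_def by (metis INF_lower ereal_less_eq(3))

lemma sdp_value_eq_opt_value: "sdp_value (spq_sdp d p m g) = opt_value p m g"
proof (rule antisym)
  have obj: "objective (spq_sdp d p m g) = (\<lambda>v. v Gamma)"
    by (simp add: spq_sdp_def)
  show "sdp_value (spq_sdp d p m g) \<le> opt_value p m g"
    unfolding sdp_value_def opt_value_def obj
    by (intro SUP_least INF_greatest) (simp add: weak_duality)
  obtain z where "z \<in> K"
    using Slater by (auto simp: constraint_set_def intro: less_imp_le)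
  then have "opt_value p m g \<le> ereal (meval p z)"
    unfolding opt_value_def by (rule INF_lower)
  \<comment> \<open>The Slater point makes \<open>K\<close> nonempty and excludes the value
    \<open>\<infinity>\<close>; for \<open>-\<infinity>\<close> the inequality is trivial.\<close>
  then consider c where "opt_value p m g = ereal c" | "opt_value p m g = -\<infinity>"
    by (cases "opt_value p m g") auto
  then show "opt_value p m g \<le> sdp_value (spq_sdp d p m g)"
  proof cases
    case 1
    then obtain v where "v \<in> sdp_feasible (spq_sdp d p m g)" "v Gamma = c"
      using convex_sdp_feasible opt_value_lower_bound by metis
    then show ?thesis
      unfolding sdp_value_def obj 1 by (metis (mono_tags, lifting) SUP_upper)
  qed simp
qed

lemma sdp_value_eq_dual: "sdp_value (spq_sdp d p m g) = (SUP (\<gamma>, y)\<in>dual_feasible d p m g. ereal \<gamma>)"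
proof (rule antisym)
  have obj: "objective (spq_sdp d p m g) = (\<lambda>v. v Gamma)"
    by (simp add: spq_sdp_def)
  show "sdp_value (spq_sdp d p m g) \<le> (SUP (\<gamma>, y)\<in>dual_feasible d p m g. ereal \<gamma>)"
    unfolding sdp_value_def obj
  proof (rule SUP_least)
    fix v assume "v \<in> sdp_feasible (spq_sdp d p m g)"
    then have "(v Gamma, \<lambda>i. v (Mult i)) \<in> dual_feasible d p m g"
      unfolding dual_feasible_iff_sdp_feasible by blast
    then show "ereal (v Gamma) \<le> (SUP (\<gamma>, y)\<in>dual_feasible d p m g. ereal \<gamma>)"
      by (rule SUP_upper2) simp
  qed
  show "(SUP (\<gamma>, y)\<in>dual_feasible d p m g. ereal \<gamma>) \<le> sdp_value (spq_sdp d p m g)"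
    unfolding sdp_value_def obj
  proof (rule SUP_least, clarify)
    fix \<gamma> y assume "(\<gamma>, y) \<in> dual_feasible d p m g"
    then obtain v where v: "v \<in> sdp_feasible (spq_sdp d p m g)" "v Gamma = \<gamma>"
      unfolding dual_feasible_iff_sdp_feasible by blast
    from v(1) show "ereal \<gamma> \<le> (SUP v\<in>sdp_feasible (spq_sdp d p m g). ereal (v Gamma))"
      by (rule SUP_upper2) (simp add: v(2))
  qed
qed

lemma strictly_convex_minimizer:
  assumes "strictly_convex (meval p)"
  obtains xs where "xs \<in> K" "\<And>x. x \<in> K \<Longrightarrow> meval p xs \<le> meval p x"
proof -
  obtain z where z: "z \<in> K"
    using Slater by (auto simp: constraint_set_def intro: less_imp_le)
  define S where "S = K \<inter> {x. meval p x \<le> meval p z}"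
  have "K = (\<Inter>i<m. {x. meval (g i) x \<le> 0})"
    by (auto simp: constraint_set_def)
  then have "closed S"
    unfolding S_def by (auto intro!: closed_Int closed_INT closed_Collect_le continuous_on_meval continuous_intros)
  moreover have "\<exists>P. \<forall>t. meval p (x + t *\<^sub>R h) = poly P t" for x h
    using meval_line by metis
  then have "bounded {x. meval p x \<le> meval p z}"
    using strictly_convex_bounded_sublevel[OF assms continuous_on_meval] by blast
  then have "bounded S"
    unfolding S_def by (rule bounded_subset) auto
  ultimately have "compact S"
    by (simp add: compact_eq_bounded_closed)
  moreover have "z \<in> S" using z by (simp add: S_def)
  ultimately obtain xs where xs: "xs \<in> S" "\<And>x. x \<in> S \<Longrightarrow> meval p xs \<le> meval p x"
    using continuous_attains_inf[of S "meval p"] continuous_on_meval by (metis empty_iff)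
  show thesis
  proof (rule that)
    show "xs \<in> K" using xs(1) by (simp add: S_def)
    show "meval p xs \<le> meval p x" if "x \<in> K" for x
      using xs that by (cases "meval p x \<le> meval p z") (auto simp: S_def)
  qed
qed

text \<open>Complementary slackness: at \<open>xs\<close> the certificate \<open>F\<close> equals
  the weighted sum of the constraints, which is at most 0, while \<open>F\<close> is a sum of
  nonnegative parts. So each part vanishes there, and strict convexity of \<open>F\<close> leaves
  room for only one zero.\<close>

lemma optimal_solution_zeros:
  assumes strict: "strictly_convex (meval p)" and xs: "xs \<in> K"
    and v: "v \<in> sdp_feasible (spq_sdp d p m g)" "v Gamma = meval p xs"
  shows "poly (univ_part d v i) (xs $ i) = 0" "meval (quad_part v) xs = 0"
    and "{z. (\<forall>i\<in>{i. univ_part d v i \<noteq> 0}. poly (univ_part d v i) (z $ i) = 0) \<and>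
      meval (quad_part v) z = 0} = {xs}"
proof -
  define F where "F = L (v Gamma) (\<lambda>i. v (Mult i))"
  have y: "0 \<le> v (Mult i)" if "i < m" for i
    using v(1) that by (simp add: feasible_iff del: basis.simps)
  have "F = quad_part v + (\<Sum>i\<in>UNIV. in_var i (univ_part d v i))"
    using v(1) by (simp add: feasible_iff F_def del: basis.simps)
  then have F: "meval F z = meval (quad_part v) z + (\<Sum>i\<in>UNIV. poly (univ_part d v i) (z $ i))" for z
    by simp
  note nonneg = feasible_parts_nonneg(1)[OF v(1)] feasible_parts_nonneg(2)[OF v(1), unfolded nonneg_def, rule_format]
  have F_nonneg: "0 \<le> meval F z" for z
    unfolding F by (intro add_nonneg_nonneg sum_nonneg nonneg)
  have "meval F xs = (\<Sum>i<m. v (Mult i) * meval (g i) xs)"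
    by (simp add: F_def meval_lagrangian v(2))
  also have "\<dots> \<le> 0"
    using xs y by (intro sum_nonpos mult_nonneg_nonpos) (auto simp: constraint_set_def)
  finally have F_xs: "meval F xs = 0"
    using F_nonneg[of xs] by linarith
  have sum_nn: "0 \<le> (\<Sum>i\<in>UNIV. poly (univ_part d v i) (xs $ i))"
    by (intro sum_nonneg nonneg)
  from F_xs have "meval (quad_part v) xs = 0" "(\<Sum>i\<in>UNIV. poly (univ_part d v i) (xs $ i)) = 0"
    using sum_nn nonneg(2)[of xs] unfolding F by linarith+
  then show zero: "meval (quad_part v) xs = 0" "poly (univ_part d v i) (xs $ i) = 0" for i
    using nonneg(1) by (auto simp: sum_nonneg_eq_0_iff)
  have strict_F: "strictly_convex (meval F)"
    unfolding F_def by (rule strictly_convex_lagrangian[OF strict]) (use g(3) y in auto)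
  have "z = xs" if z: "\<forall>i\<in>{i. univ_part d v i \<noteq> 0}. poly (univ_part d v i) (z $ i) = 0"
      "meval (quad_part v) z = 0" for z
  proof (rule ccontr)
    assume "z \<noteq> xs"
    \<comment> \<open>A zero polynomial puts no condition on its coordinate but contributes nothing
      to \<open>F\<close>.\<close>
    have "poly (univ_part d v i) (z $ i) = 0" for i
      using z(1) by (cases "univ_part d v i = 0") auto
    then have "meval F z = 0"
      by (simp add: F z(2))
    \<comment> \<open>At the midpoint of two distinct zeros the strictly convex \<open>F\<close>
      would be negative.\<close>
    then have "meval F ((1 - 1/2) *\<^sub>R z + (1/2) *\<^sub>R xs) < 0"
      using strict_F[unfolded strictly_convex_def, rule_format, of z xs "1/2"] \<open>z \<noteq> xs\<close> F_xs by simp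
    then show False
      using F_nonneg[of "(1 - 1/2) *\<^sub>R z + (1/2) *\<^sub>R xs"] by linarith
  qed
  then show "{z. (\<forall>i\<in>{i. univ_part d v i \<noteq> 0}. poly (univ_part d v i) (z $ i) = 0) \<and>
      meval (quad_part v) z = 0} = {xs}"
    using zero by blast
qed

text \<open>With convex univariate parts each nonzero one determines its coordinate by itself; only
  the coordinates with zero univariate part are left to the quadratic polynomial.\<close>

lemma optimal_solution_zeros_convex:
  assumes strict: "strictly_convex (meval p)" and xs: "xs \<in> K"
    and v: "v \<in> sdp_feasible (spq_sdp_convex d p m g)" "v Gamma = meval p xs"
  shows "\<forall>i\<in>{i. univ_part d v i \<noteq> 0}. {t. poly (univ_part d v i) t = 0} = {xs $ i}"
    and "{z. (\<forall>i\<in>{i. univ_part d v i \<noteq> 0}. z $ i = xs $ i) \<and> meval (quad_part v) z = 0} = {xs}"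
proof -
  have v': "v \<in> sdp_feasible (spq_sdp d p m g)"
    using v(1) by (simp add: spq_sdp_convex_feasible_iff)
  note zeros = optimal_solution_zeros[OF strict xs v' v(2)]
  have "0 \<le> poly (pderiv (pderiv (univ_part d v i))) t" for i t
    using v(1) poly_curv_part_nonneg[of d i v t]
    by (simp add: spq_sdp_convex_feasible_iff del: basis.simps)
  then have unique: "t = xs $ i" if "univ_part d v i \<noteq> 0" "poly (univ_part d v i) t = 0" for i t
    using nonneg_convex_poly_unique_zero[of "univ_part d v i" t "xs $ i"]
      feasible_parts_nonneg(1)[OF v'] zeros(1) that by blast
  then show roots: "\<forall>i\<in>{i. univ_part d v i \<noteq> 0}. {t. poly (univ_part d v i) t = 0} = {xs $ i}"
    using zeros(1) by blast
  then have "(\<forall>i\<in>{i. univ_part d v i \<noteq> 0}. z $ i = xs $ i) \<longleftrightarrow>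
      (\<forall>i\<in>{i. univ_part d v i \<noteq> 0}. poly (univ_part d v i) (z $ i) = 0)" for z :: "real ^ 'n"
    using zeros(1) unique by (metis (mono_tags, lifting) mem_Collect_eq)
  with zeros(3) show "{z. (\<forall>i\<in>{i. univ_part d v i \<noteq> 0}. z $ i = xs $ i) \<and> meval (quad_part v) z = 0} = {xs}"
    by simp
qed

end

lemma objective_spq_sdp: "objective (spq_sdp d p m g) v = v Gamma"
  and objective_spq_sdp_convex: "objective (spq_sdp_convex d p m g) v = v Gamma"
  by (simp_all add: spq_sdp_convex_def spq_sdp_def Let_def)

text \<open>The set \<open>I\<close> keeps only the nonzero univariate parts, at most one per
  variable. Equality of the zero sets with singletons expresses that any zeros found are already the
  coordinates of the optimal solution. Both programs are treated: the zeros are solved for jointly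
  in the first, coordinate by coordinate in the second.\<close>

theorem theorem5p6:
  fixes d m :: nat
    and p :: "'n::finite mpoly"
    and g :: "nat \<Rightarrow> 'n mpoly"
  assumes "d \<ge> 1"
    and "spq p" "total_degree p \<le> 2 * d" "convex_on UNIV (meval p)"
    and "\<And>i. i < m \<Longrightarrow> spq (g i) \<and> total_degree (g i) \<le> 2 * d \<and> convex_on UNIV (meval (g i))"
    and Slater: "\<exists>xbar. \<forall>i<m. meval (g i) xbar < 0"
  shows
    "opt_value p m g = (SUP (\<gamma>, y)\<in>dual_feasible d p m g. ereal \<gamma>) \<and>
     semidefinite_program (spq_sdp d p m g) \<and>
     sdp_value (spq_sdp d p m g) = opt_value p m g \<and>
     (\<forall>\<gamma> y. (\<gamma>, y) \<in> dual_feasible d p m g \<longleftrightarrow>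
        (\<exists>v\<in>sdp_feasible (spq_sdp d p m g). v Gamma = \<gamma> \<and> (\<forall>i<m. v (Mult i) = y i))) \<and>
     (strictly_convex (meval p) \<longrightarrow>
        (\<exists>xs\<in>constraint_set m g. ereal (meval p xs) = opt_value p m g \<and>
           sdp_optimal (spq_sdp d p m g) \<noteq> {} \<and>
           (\<forall>v\<in>sdp_optimal (spq_sdp d p m g).
              let u = univ_part d v; q = quad_part v; I = {i. u i \<noteq> 0} in
              (\<forall>i t. 0 \<le> poly (u i) t) \<and> quadratic q \<and> nonneg q \<and>
              {z. (\<forall>i\<in>I. poly (u i) (z $ i) = 0) \<and> meval q z = 0} = {xs}) \<and>
           semidefinite_program (spq_sdp_convex d p m g) \<and>
           sdp_optimal (spq_sdp_convex d p m g) \<noteq> {} \<and>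
           (\<forall>v\<in>sdp_optimal (spq_sdp_convex d p m g).
              let u = univ_part d v; q = quad_part v; I = {i. u i \<noteq> 0} in
              (\<forall>i t. 0 \<le> poly (u i) t) \<and> quadratic q \<and> nonneg q \<and>
              (\<forall>i\<in>I. {t. poly (u i) t = 0} = {xs $ i}) \<and>
              {z. (\<forall>i\<in>I. z $ i = xs $ i) \<and> meval q z = 0} = {xs})))"
proof -
  interpret convex_spq_problem d m p g
    using assms by unfold_locales auto
  have "\<exists>xs\<in>constraint_set m g. ereal (meval p xs) = opt_value p m g \<and>
           sdp_optimal (spq_sdp d p m g) \<noteq> {} \<and>
           (\<forall>v\<in>sdp_optimal (spq_sdp d p m g).
              let u = univ_part d v; q = quad_part v; I = {i. u i \<noteq> 0} in
              (\<forall>i t. 0 \<le> poly (u i) t) \<and> quadratic q \<and> nonneg q \<and>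
              {z. (\<forall>i\<in>I. poly (u i) (z $ i) = 0) \<and> meval q z = 0} = {xs}) \<and>
           semidefinite_program (spq_sdp_convex d p m g) \<and>
           sdp_optimal (spq_sdp_convex d p m g) \<noteq> {} \<and>
           (\<forall>v\<in>sdp_optimal (spq_sdp_convex d p m g).
              let u = univ_part d v; q = quad_part v; I = {i. u i \<noteq> 0} in
              (\<forall>i t. 0 \<le> poly (u i) t) \<and> quadratic q \<and> nonneg q \<and>
              (\<forall>i\<in>I. {t. poly (u i) t = 0} = {xs $ i}) \<and>
              {z. (\<forall>i\<in>I. z $ i = xs $ i) \<and> meval q z = 0} = {xs})"
    if strict: "strictly_convex (meval p)"
  proof -
    obtain xs where xs: "xs \<in> K" "\<And>x. x \<in> K \<Longrightarrow> meval p xs \<le> meval p x"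
      using strictly_convex_minimizer[OF strict] by blast
    have value_xs: "ereal (meval p xs) = opt_value p m g"
      unfolding opt_value_def using xs by (intro antisym INF_greatest INF_lower) auto
    \<comment> \<open>One vector, feasible for both programs with objective value
      \<open>meval p xs\<close>, is optimal in both by weak duality. It serves below as the
      comparison that forces this value on every optimal solution.\<close>
    obtain w where w: "w \<in> sdp_feasible (spq_sdp_convex d p m g)" "w \<in> sdp_feasible (spq_sdp d p m g)"
        "w Gamma = meval p xs"
      using convex_sdp_feasible[of "meval p xs"] xs(2) by blast
    have le: "v Gamma \<le> w Gamma" if "v \<in> sdp_feasible (spq_sdp d p m g)" for v
      using weak_duality[OF that xs(1)] by (simp add: w(3))
    have "w \<in> sdp_optimal (spq_sdp d p m g)" "w \<in> sdp_optimal (spq_sdp_convex d p m g)"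
      using w le
      by (auto simp: sdp_optimal_def objective_spq_sdp objective_spq_sdp_convex spq_sdp_convex_feasible_iff)
    then have nonempty: "sdp_optimal (spq_sdp d p m g) \<noteq> {}" "sdp_optimal (spq_sdp_convex d p m g) \<noteq> {}"
      by auto
    have opt: "v \<in> sdp_feasible (spq_sdp d p m g)" "v Gamma = meval p xs"
      if "v \<in> sdp_optimal (spq_sdp d p m g)" for v
    proof -
      show v: "v \<in> sdp_feasible (spq_sdp d p m g)"
        using that by (simp add: sdp_optimal_def)
      have "w Gamma \<le> v Gamma"
        using that w(2) by (simp add: sdp_optimal_def objective_spq_sdp)
      with le[OF v] w(3) show "v Gamma = meval p xs" by simp
    qed
    have opt_convex: "v \<in> sdp_feasible (spq_sdp_convex d p m g)"
      "v \<in> sdp_feasible (spq_sdp d p m g)" "v Gamma = meval p xs"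
      if "v \<in> sdp_optimal (spq_sdp_convex d p m g)" for v
    proof -
      show "v \<in> sdp_feasible (spq_sdp_convex d p m g)"
        using that by (simp add: sdp_optimal_def)
      then show v: "v \<in> sdp_feasible (spq_sdp d p m g)"
        by (simp add: spq_sdp_convex_feasible_iff)
      have "w Gamma \<le> v Gamma"
        using that w(1) by (simp add: sdp_optimal_def objective_spq_sdp_convex)
      with le[OF v] w(3) show "v Gamma = meval p xs" by simp
    qed
    have zeros: "{z. (\<forall>i\<in>{i. univ_part d v i \<noteq> 0}. poly (univ_part d v i) (z $ i) = 0) \<and>
        meval (quad_part v) z = 0} = {xs}" if "v \<in> sdp_optimal (spq_sdp d p m g)" for v
      by (rule optimal_solution_zeros(3)[OF strict xs(1) opt[OF that]])
    have zeros_convex: "\<forall>i\<in>{i. univ_part d v i \<noteq> 0}. {t. poly (univ_part d v i) t = 0} = {xs $ i}"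
      "{z. (\<forall>i\<in>{i. univ_part d v i \<noteq> 0}. z $ i = xs $ i) \<and> meval (quad_part v) z = 0} = {xs}"
      if "v \<in> sdp_optimal (spq_sdp_convex d p m g)" for v
      by (rule optimal_solution_zeros_convex[OF strict xs(1) opt_convex(1,3)[OF that]])+
    show ?thesis
      unfolding Let_def
      using xs(1) value_xs nonempty semidefinite_program_spq_sdp_convex
        feasible_parts_nonneg[OF opt(1)] feasible_parts_nonneg[OF opt_convex(2)] quadratic_quad_part
      by (intro bexI[of _ xs] conjI ballI allI zeros
          zeros_convex(1)[THEN bspec] zeros_convex(2)) simp_all
  qed
  then show ?thesis
    using sdp_value_eq_opt_value sdp_value_eq_dual semidefinite_program_spq_sdp
      dual_feasible_iff_sdp_feasible
    by (intro conjI impI allI) simp_all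
qed

end
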